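(* Let $(\mathfrak g,g,J)$ be a $2n$-dimensional almost Hermitian Lie algebra and $U_J:=(\mathfrak g'\oplus J\mathfrak g')^\perp$ (in the cases below $\mathfrak g'\cap J\mathfrak g'=\{0\}$). (a) If $\dim(\mathfrak g')=1$, then $(\mathfrak g,g,J)$ is an SKT Lie algebra if and only if there exists $X\in\mathfrak g'$ of norm one such that (i) there exist $\lambda\in\mathbb R\setminus\{0\}$ and $\mu\in U_J^*$ so that the only non-zero Lie brackets (up to anti-symmetry) are given by $[JX,X]=\lambda X$, $[Y,X]=\mu(Y)X$, $[Y,JX]=-\mu(JY)X$ and $[Y,Z]=\frac1\lambda(\mu\wedge\mu\circ J)(Y,Z)X$ for $Y,Z\in U_J$, or (ii) there exists $\alpha\in U_J^*\setminus\{0\}$ so that the only non-zero Lie bracket is given by $[Y,Z]=(\alpha\wedge J^*\alpha)(Y,Z)X$ for $Y,Z\in U_J$. In the first case $\mathfrak g\cong\mathfrak{aff}_{\mathbb R}\oplus\mathbb R^{2n-2}$, whereas in the second case $\mathfrak g\cong\mathfrak h_3\oplus\mathbb R^{2n-3}$. (b) If $\dim(\mathfrak g')=2$ and $\mathfrak g'$ is totally real, then $(\mathfrak g,g,J)$ is an SKT Lie algebra if and only if there exists an orthonormal basis $(X_1,X_2)$ of $\mathfrak g'$ such that (i) there exist $\lambda_1,\lambda_2\in\mathbb R\setminus\{0\}$ and $\mu_1,\mu_2\in U_J^*$ so that the only non-zero Lie brackets (up to anti-symmetry) are given by $[JX_i,X_i]=\lambda_iX_i$, $[Y,X_i]=\mu_i(Y)X_i$,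 $[Y,JX_i]=-\mu_i(JY)X_i$ for $i=1,2$ and $[Y,Z]=\sum_{i=1}^2\frac1{\lambda_i}(\mu_i\wedge\mu_i\circ J)(Y,Z)X_i$ for $Y,Z\in U_J$, (ii) or there exist $\lambda\in\mathbb R\setminus\{0\}$ and $\mu,\alpha\in U_J^*$, $\alpha\ne0$, so that the only non-zero Lie brackets (up to anti-symmetry) are given by $[JX_1,X_1]=\lambda X_1$, $[Y,X_1]=\mu(Y)X_1$, $[Y,JX_1]=-\mu(JY)X_1$ and $[Y,Z]=\frac1\lambda(\mu\wedge\mu\circ J)(Y,Z)X_1+(\alpha\wedge J^*\alpha)(Y,Z)X_2$ for $Y,Z\in U_J$, (iii) or there exist $\mathbb C$-linearly independent $\alpha,\beta\in U_J^*$ so that the only non-zero Lie bracket is given by $[Y,Z]=(\alpha\wedge J^*\alpha)(Y,Z)X_1+(\beta\wedge J^*\beta)(Y,Z)X_2$ for $Y,Z\in U_J$. In the first case $\mathfrak g\cong2\mathfrak{aff}_{\mathbb R}\oplus\mathbb R^{2n-4}$, in the second case $\mathfrak g\cong\mathfrak{aff}_{\mathbb R}\oplus\mathfrak h_3\oplus\mathbb R^{2n-5}$ and in the third case $\mathfrak g\cong2\mathfrak h_3\oplus\mathbb R^{2n-6}$.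
   Context: An almost Hermitian Lie algebra $(\mathfrak g,g,J)$ is a finite-dimensional real Lie algebra with an inner product $g$ and an endomorphism $J$, $J^2=-\mathrm{id}$, with $g(J\cdot,J\cdot)=g$; put $\sigma=g(J\cdot,\cdot)$. It is SKT if $J$ is integrable ($[JX,JY]-J[JX,Y]-J[X,JY]-[X,Y]=0$) and $d(J^*d\sigma)=0$, where $d$ is the Chevalley–Eilenberg differential and $(J^*\beta)(X_1,\dots,X_k)=\beta(JX_1,\dots,JX_k)$; in particular $J^*\alpha=\alpha\circ J$ for one-forms. $\mathfrak g'=[\mathfrak g,\mathfrak g]$; $\mathfrak g'$ is totally real if $\mathfrak g'\cap J\mathfrak g'=\{0\}$. Wedge convention: $(\alpha\wedge\beta)(Y,Z)=\alpha(Y)\beta(Z)-\alpha(Z)\beta(Y)$. $\mathbb C$-linear independence in $U_J^*$ is with respect to the complex structure $J^*$. $\mathfrak{aff}_{\mathbb R}$ is the two-dimensional non-Abelian Lie algebra, $\mathfrak h_3$ the three-dimensional Heisenberg algebra, and $2\mathfrak k=\mathfrak k\oplus\mathfrak k$. *)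

theory Defs
  imports "HOL-Analysis.Analysis" "HOL-Library.Function_Algebras"
begin

text \<open>The inner product \<open>g\<close> is the inner product of the type class \<^class>\<open>euclidean_space\<close>.\<close>

locale lie_algebra =
  fixes br :: "'a::real_vector \<Rightarrow> 'a \<Rightarrow> 'a"
  assumes bilinear_br: "bilinear br"
    and br_self: "br x x = 0"
    and jacobi: "br x (br y z) + br y (br z x) + br z (br x y) = 0"

locale almost_hermitian_lie_algebra = lie_algebra br
  for br :: "'a::euclidean_space \<Rightarrow> 'a \<Rightarrow> 'a" +
  fixes J :: "'a \<Rightarrow> 'a"
  assumes linear_J: "linear J"
    and J_J: "J (J x) = - x"
    and inner_J: "J x \<bullet> J y = x \<bullet> y"

definition derived_algebra :: "('a::real_vector \<Rightarrow> 'a \<Rightarrow> 'a) \<Rightarrow> 'a set" where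
  "derived_algebra br = span {br x y | x y. True}"

definition totally_real :: "('a::real_vector \<Rightarrow> 'a) \<Rightarrow> 'a set \<Rightarrow> bool" where
  "totally_real J V \<longleftrightarrow> V \<inter> J ` V = {0}"

definition U_space :: "('a::euclidean_space \<Rightarrow> 'a \<Rightarrow> 'a) \<Rightarrow> ('a \<Rightarrow> 'a) \<Rightarrow> 'a set" where
  "U_space br J =
    orthogonal_comp {x + y | x y. x \<in> derived_algebra br \<and> y \<in> J ` derived_algebra br}"

text \<open>A \<open>k\<close>-form is represented by a function on argument lists, of which only the values on lists
  of length \<open>k\<close> matter; positions are counted from 0, and \<open>nths Xs (- {i, j})\<close> omits the
  \<open>i\<close>-th and \<open>j\<close>-th arguments.\<close>

definition ce_d :: "('a \<Rightarrow> 'a \<Rightarrow> 'a) \<Rightarrow> ('a list \<Rightarrow> real) \<Rightarrow> 'a list \<Rightarrow> real" where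
  "ce_d br \<omega> Xs =
    (\<Sum>j<length Xs. \<Sum>i<j. (-1) ^ (i + j) * \<omega> (br (Xs ! i) (Xs ! j) # nths Xs (- {i, j})))"

definition pullback :: "('a \<Rightarrow> 'a) \<Rightarrow> ('a list \<Rightarrow> real) \<Rightarrow> 'a list \<Rightarrow> real" where
  "pullback J \<omega> Xs = \<omega> (map J Xs)"

definition fundamental_form :: "('a::real_inner \<Rightarrow> 'a) \<Rightarrow> 'a list \<Rightarrow> real" where
  "fundamental_form J Xs = J (Xs ! 0) \<bullet> (Xs ! 1)"

definition integrable_structure :: "('a::real_vector \<Rightarrow> 'a \<Rightarrow> 'a) \<Rightarrow> ('a \<Rightarrow> 'a) \<Rightarrow> bool" where
  "integrable_structure br J \<longleftrightarrow>
    (\<forall>X Y. br (J X) (J Y) - J (br (J X) Y) - J (br X (J Y)) - br X Y = 0)"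

definition SKT :: "('a::real_inner \<Rightarrow> 'a \<Rightarrow> 'a) \<Rightarrow> ('a \<Rightarrow> 'a) \<Rightarrow> bool" where
  "SKT br J \<longleftrightarrow> integrable_structure br J \<and>
    (\<forall>Xs. length Xs = 4 \<longrightarrow> ce_d br (pullback J (ce_d br (fundamental_form J))) Xs = 0)"

text \<open>The dual of a subspace \<open>U\<close>: a linear functional on \<open>U\<close> is identified with its extension
  by zero to the orthogonal complement of \<open>U\<close>, so that it vanishes on \<open>U\<close> iff it is zero.\<close>

definition dual_space :: "'a::euclidean_space set \<Rightarrow> ('a \<Rightarrow> real) set" where
  "dual_space U = {\<alpha>. linear \<alpha> \<and> (\<forall>x \<in> orthogonal_comp U. \<alpha> x = 0)}"

definition wedge :: "('a \<Rightarrow> real) \<Rightarrow> ('a \<Rightarrow> real) \<Rightarrow> 'a \<Rightarrow> 'a \<Rightarrow> real" where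
  "wedge \<alpha> \<beta> Y Z = \<alpha> Y * \<beta> Z - \<alpha> Z * \<beta> Y"

text \<open>Multiplication of a one-form by a complex number, where \<open>\<i>\<close> acts as \<open>\<alpha> \<mapsto> \<alpha> \<circ> J\<close>.\<close>

definition cscale :: "('a \<Rightarrow> 'a) \<Rightarrow> complex \<Rightarrow> ('a \<Rightarrow> real) \<Rightarrow> 'a \<Rightarrow> real" where
  "cscale J z \<alpha> Y = Re z * \<alpha> Y + Im z * (\<alpha> \<circ> J) Y"

definition complex_independent :: "('a \<Rightarrow> 'a) \<Rightarrow> ('a \<Rightarrow> real) \<Rightarrow> ('a \<Rightarrow> real) \<Rightarrow> bool" where
  "complex_independent J \<alpha> \<beta> \<longleftrightarrow>
    (\<forall>z w. (\<forall>Y. cscale J z \<alpha> Y + cscale J w \<beta> Y = 0) \<longrightarrow> z = 0 \<and> w = 0)"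

text \<open>In each case the brackets of all pairs taken from the vectors \<open>X\<close>, \<open>J X\<close> (respectively
  \<open>X1\<close>, \<open>X2\<close>, \<open>J X1\<close>, \<open>J X2\<close>) and the subspace \<open>U_space br J\<close> are specified up to
  anti-symmetry; those not mentioned as non-zero are required to vanish.\<close>

definition case_a_i :: "('a::euclidean_space \<Rightarrow> 'a \<Rightarrow> 'a) \<Rightarrow> ('a \<Rightarrow> 'a) \<Rightarrow> 'a \<Rightarrow> bool" where
  "case_a_i br J X \<longleftrightarrow> (\<exists>l \<mu>. l \<noteq> 0 \<and> \<mu> \<in> dual_space (U_space br J) \<and>
     br (J X) X = l *\<^sub>R X \<and>
     (\<forall>Y \<in> U_space br J. br Y X = \<mu> Y *\<^sub>R X \<and> br Y (J X) = - \<mu> (J Y) *\<^sub>R X) \<and>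
     (\<forall>Y \<in> U_space br J. \<forall>Z \<in> U_space br J.
        br Y Z = ((1 / l) * wedge \<mu> (\<mu> \<circ> J) Y Z) *\<^sub>R X))"

definition case_a_ii :: "('a::euclidean_space \<Rightarrow> 'a \<Rightarrow> 'a) \<Rightarrow> ('a \<Rightarrow> 'a) \<Rightarrow> 'a \<Rightarrow> bool" where
  "case_a_ii br J X \<longleftrightarrow> (\<exists>\<alpha> \<in> dual_space (U_space br J). \<alpha> \<noteq> (\<lambda>_. 0) \<and>
     br (J X) X = 0 \<and>
     (\<forall>Y \<in> U_space br J. br Y X = 0 \<and> br Y (J X) = 0) \<and>
     (\<forall>Y \<in> U_space br J. \<forall>Z \<in> U_space br J. br Y Z = wedge \<alpha> (\<alpha> \<circ> J) Y Z *\<^sub>R X))"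

definition orthonormal_basis2 :: "'a::euclidean_space set \<Rightarrow> 'a \<Rightarrow> 'a \<Rightarrow> bool" where
  "orthonormal_basis2 V X1 X2 \<longleftrightarrow>
     norm X1 = 1 \<and> norm X2 = 1 \<and> X1 \<bullet> X2 = 0 \<and> span {X1, X2} = V"

definition case_b_i ::
  "('a::euclidean_space \<Rightarrow> 'a \<Rightarrow> 'a) \<Rightarrow> ('a \<Rightarrow> 'a) \<Rightarrow> 'a \<Rightarrow> 'a \<Rightarrow> bool" where
  "case_b_i br J X1 X2 \<longleftrightarrow> (\<exists>l1 l2 \<mu>1 \<mu>2. l1 \<noteq> 0 \<and> l2 \<noteq> 0 \<and>
     \<mu>1 \<in> dual_space (U_space br J) \<and> \<mu>2 \<in> dual_space (U_space br J) \<and>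
     br (J X1) X1 = l1 *\<^sub>R X1 \<and> br (J X2) X2 = l2 *\<^sub>R X2 \<and>
     br X1 X2 = 0 \<and> br (J X1) (J X2) = 0 \<and> br (J X1) X2 = 0 \<and> br (J X2) X1 = 0 \<and>
     (\<forall>Y \<in> U_space br J.
        br Y X1 = \<mu>1 Y *\<^sub>R X1 \<and> br Y (J X1) = - \<mu>1 (J Y) *\<^sub>R X1 \<and>
        br Y X2 = \<mu>2 Y *\<^sub>R X2 \<and> br Y (J X2) = - \<mu>2 (J Y) *\<^sub>R X2) \<and>
     (\<forall>Y \<in> U_space br J. \<forall>Z \<in> U_space br J.
        br Y Z = ((1 / l1) * wedge \<mu>1 (\<mu>1 \<circ> J) Y Z) *\<^sub>R X1
               + ((1 / l2) * wedge \<mu>2 (\<mu>2 \<circ> J) Y Z) *\<^sub>R X2))"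

definition case_b_ii ::
  "('a::euclidean_space \<Rightarrow> 'a \<Rightarrow> 'a) \<Rightarrow> ('a \<Rightarrow> 'a) \<Rightarrow> 'a \<Rightarrow> 'a \<Rightarrow> bool" where
  "case_b_ii br J X1 X2 \<longleftrightarrow> (\<exists>l \<mu> \<alpha>. l \<noteq> 0 \<and>
     \<mu> \<in> dual_space (U_space br J) \<and> \<alpha> \<in> dual_space (U_space br J) \<and> \<alpha> \<noteq> (\<lambda>_. 0) \<and>
     br (J X1) X1 = l *\<^sub>R X1 \<and> br (J X2) X2 = 0 \<and>
     br X1 X2 = 0 \<and> br (J X1) (J X2) = 0 \<and> br (J X1) X2 = 0 \<and> br (J X2) X1 = 0 \<and>
     (\<forall>Y \<in> U_space br J.
        br Y X1 = \<mu> Y *\<^sub>R X1 \<and> br Y (J X1) = - \<mu> (J Y) *\<^sub>R X1 \<and>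
        br Y X2 = 0 \<and> br Y (J X2) = 0) \<and>
     (\<forall>Y \<in> U_space br J. \<forall>Z \<in> U_space br J.
        br Y Z = ((1 / l) * wedge \<mu> (\<mu> \<circ> J) Y Z) *\<^sub>R X1 + wedge \<alpha> (\<alpha> \<circ> J) Y Z *\<^sub>R X2))"

definition case_b_iii ::
  "('a::euclidean_space \<Rightarrow> 'a \<Rightarrow> 'a) \<Rightarrow> ('a \<Rightarrow> 'a) \<Rightarrow> 'a \<Rightarrow> 'a \<Rightarrow> bool" where
  "case_b_iii br J X1 X2 \<longleftrightarrow> (\<exists>\<alpha> \<beta>.
     \<alpha> \<in> dual_space (U_space br J) \<and> \<beta> \<in> dual_space (U_space br J) \<and>
     complex_independent J \<alpha> \<beta> \<and>
     br (J X1) X1 = 0 \<and> br (J X2) X2 = 0 \<and>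
     br X1 X2 = 0 \<and> br (J X1) (J X2) = 0 \<and> br (J X1) X2 = 0 \<and> br (J X2) X1 = 0 \<and>
     (\<forall>Y \<in> U_space br J.
        br Y X1 = 0 \<and> br Y (J X1) = 0 \<and> br Y X2 = 0 \<and> br Y (J X2) = 0) \<and>
     (\<forall>Y \<in> U_space br J. \<forall>Z \<in> U_space br J.
        br Y Z = wedge \<alpha> (\<alpha> \<circ> J) Y Z *\<^sub>R X1 + wedge \<beta> (\<beta> \<circ> J) Y Z *\<^sub>R X2))"

instantiation "fun" :: (type, real_vector) real_vector
begin

definition scaleR_fun :: "real \<Rightarrow> ('a \<Rightarrow> 'b) \<Rightarrow> 'a \<Rightarrow> 'b" where
  "scaleR_fun r f = (\<lambda>x. r *\<^sub>R f x)"

instance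
  by standard (simp_all add: scaleR_fun_def fun_eq_iff scaleR_add_right scaleR_add_left)

end

text \<open>A Lie algebra carried by a linear subspace of a real vector space, so that \<open>\<real>\<^sup>k\<close> is
  available for an arbitrary natural number \<open>k\<close> (including 0).\<close>

record 'a lie_alg =
  lie_carrier :: "'a set"
  lie_bracket :: "'a \<Rightarrow> 'a \<Rightarrow> 'a"

definition whole_alg :: "('a \<Rightarrow> 'a \<Rightarrow> 'a) \<Rightarrow> 'a lie_alg" where
  "whole_alg br = \<lparr>lie_carrier = UNIV, lie_bracket = br\<rparr>"

definition abelian_alg :: "nat \<Rightarrow> (nat \<Rightarrow> real) lie_alg" where
  "abelian_alg k = \<lparr>lie_carrier = {x. \<forall>i\<ge>k. x i = 0}, lie_bracket = (\<lambda>_ _. 0)\<rparr>"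

definition aff_alg :: "(real \<times> real) lie_alg" where
  "aff_alg = whole_alg (\<lambda>(a, b) (c, d). (0, a * d - b * c))"

definition h3_alg :: "(real \<times> real \<times> real) lie_alg" where
  "h3_alg = whole_alg (\<lambda>(a, b, c) (a', b', c'). (0, 0, a * b' - b * a'))"

definition lie_sum :: "'a lie_alg \<Rightarrow> 'b lie_alg \<Rightarrow> ('a \<times> 'b) lie_alg" (infixr \<open>\<oplus>\<^sub>L\<close> 65) where
  "A \<oplus>\<^sub>L B = \<lparr>lie_carrier = lie_carrier A \<times> lie_carrier B,
     lie_bracket = (\<lambda>(a, b) (a', b'). (lie_bracket A a a', lie_bracket B b b'))\<rparr>"

text \<open>Asking for a linear map on the ambient spaces loses nothing, since every linear map on a
  linear subspace extends.\<close>

definition lie_isomorphic :: "'a::real_vector lie_alg \<Rightarrow> 'b::real_vector lie_alg \<Rightarrow> bool"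
    (infix \<open>\<cong>\<^sub>L\<close> 50) where
  "A \<cong>\<^sub>L B \<longleftrightarrow> (\<exists>f. linear f \<and> bij_betw f (lie_carrier A) (lie_carrier B) \<and>
     (\<forall>x \<in> lie_carrier A. \<forall>y \<in> lie_carrier A.
        f (lie_bracket A x y) = lie_bracket B (f x) (f y)))"

end

theory Submission
  imports Defs
begin

text \<open>Write the bracket as \<open>\<Sum>\<^sub>i \<omega>\<^sub>i X\<^sub>i\<close> for an orthonormal basis \<open>X\<^sub>i\<close> of the totally real ideal \<open>\<gg>'\<close>.
  Integrability of \<open>J\<close> says that every \<open>\<omega>\<^sub>i\<close> is \<open>J\<close>-invariant; then \<open>J\<^sup>*d\<sigma>\<close> is, up to sign,
  \<open>\<Sum>\<^sub>i \<omega>\<^sub>i \<and> g(X\<^sub>i, \<cdot>)\<close>, and by the Jacobi identity its differential is a multiple of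
  \<open>\<Sum>\<^sub>i \<omega>\<^sub>i \<and> \<omega>\<^sub>i\<close>. So SKT means invariance together with \<open>\<Sum>\<^sub>i \<omega>\<^sub>i \<and> \<omega>\<^sub>i = 0\<close>. If \<open>dim \<gg>' \<le> 2\<close>, this
  forces \<open>\<omega>\<^sub>i = \<plusminus> \<alpha>\<^sub>i \<and> J\<^sup>*\<alpha>\<^sub>i\<close> after a rotation of the basis, and the Jacobi identity makes
  \<open>\<alpha>\<^sub>i\<close> vanish on \<open>X\<^sub>j\<close>, \<open>JX\<^sub>j\<close> for \<open>j \<noteq> i\<close>. The direction \<open>X\<^sub>i\<close> contributes an affine factor if
  \<open>\<alpha>\<^sub>i\<close> does not vanish on \<open>X\<^sub>i\<close>, \<open>JX\<^sub>i\<close>, and a Heisenberg factor otherwise.\<close>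

subsection \<open>Invariant two-forms\<close>

text \<open>Two difficulties shape the proof. With two components,
  \<open>\<omega>1 \<and> \<omega>1 + \<omega>2 \<and> \<omega>2 = 0\<close> makes neither form
  decomposable by itself; a rotation must be found, and its angle comes from explicit coordinates on
  a complex plane. Moreover, the lists of brackets use one-forms extended by zero from
  \<open>U\<close>, whereas decomposability produces one-forms on the whole algebra. Both directions
  therefore meet in a normal form: the bracket is a sum of terms
  \<open>c (\<gamma> \<and> \<gamma> \<circ> J) X\<close> with global \<open>\<gamma>\<close>. It
  yields the SKT condition because each term has square zero and the vectors \<open>X\<close> are
  orthogonal. The translation rests on one fact: a complex number u acting on
  \<open>\<gamma>\<close>, with i acting as composition with \<open>J\<close>, multiplies
  \<open>\<gamma> \<and> \<gamma> \<circ> J\<close> by |u|^2. For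
  \<open>\<omega> = \<alpha> \<and> \<alpha> \<circ> J\<close> the one-form \<omega>(.,X) is such a
  multiple of \<open>\<alpha>\<close>, with |u|^2 = \<omega>(JX,X); this is the origin of \<lambda>
  and of the factor 1/\<lambda>. Signs are absorbed in the basis vectors, so the \<lambda> found is
  positive, while the lists allow either sign.\<close>

text \<open>Half the value of \<open>\<omega> \<and> \<omega>\<close>.\<close>

definition pfaffian :: "('a \<Rightarrow> 'a \<Rightarrow> real) \<Rightarrow> 'a \<Rightarrow> 'a \<Rightarrow> 'a \<Rightarrow> 'a \<Rightarrow> real" where
  "pfaffian \<omega> x y z w = \<omega> x y * \<omega> z w - \<omega> x z * \<omega> y w + \<omega> x w * \<omega> y z"

definition invariant_form :: "('a::real_vector \<Rightarrow> 'a) \<Rightarrow> ('a \<Rightarrow> 'a \<Rightarrow> real) \<Rightarrow> bool" where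
  "invariant_form J \<omega> \<longleftrightarrow> bilinear \<omega> \<and> (\<forall>x. \<omega> x x = 0) \<and> (\<forall>x y. \<omega> (J x) (J y) = \<omega> x y)"

lemma alternating_antisym:
  assumes "bilinear \<omega>" "\<And>x. \<omega> x x = 0"
  shows "\<omega> y x = - \<omega> x y"
proof -
  have "\<omega> (x + y) (x + y) = \<omega> x x + \<omega> x y + \<omega> y x + \<omega> y y"
    using assms(1) by (simp add: bilinear_ladd bilinear_radd)
  then have "\<omega> x y + \<omega> y x = 0"
    using assms(2) by simp
  then show ?thesis by (simp add: eq_neg_iff_add_eq_0 add.commute)
qed

lemma wedge_scale: "wedge (\<lambda>x. c * \<alpha> x) (\<lambda>x. d * \<beta> x) y z = c * d * wedge \<alpha> \<beta> y z"
  by (simp add: wedge_def algebra_simps)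

text \<open>The Pluecker relation: a product of two one-forms has square zero.\<close>

lemma pfaffian_wedge: "pfaffian (\<lambda>x y. c * wedge \<alpha> \<beta> x y) x y z w = 0"
  unfolding pfaffian_def wedge_def by algebra

context
  fixes J :: "'a::real_vector \<Rightarrow> 'a"
  assumes lin: "linear J" and JJ: "\<And>x. J (J x) = - x"
begin

lemma invariant_form_J:
  assumes "invariant_form J \<omega>"
  shows "\<omega> (J x) y = - \<omega> x (J y)"
proof -
  have "\<omega> (J (J x)) (J y) = \<omega> (J x) y"
    using assms by (simp add: invariant_form_def)
  then show ?thesis
    using assms by (simp add: invariant_form_def JJ bilinear_lneg)
qed

lemma invariant_form_antisym:
  assumes "invariant_form J \<omega>"
  shows "\<omega> y x = - \<omega> x y"
  using assms alternating_antisym unfolding invariant_form_def by metis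

text \<open>By invariance \<open>\<omega> x (J y)\<close> is symmetric in \<open>x\<close> and
  \<open>y\<close>, so polarisation recovers it from its diagonal.\<close>

lemma invariant_form_nonzero_line:
  assumes "bilinear \<omega>" "\<And>x. \<omega> x x = 0" "\<And>x y. \<omega> (J x) (J y) = \<omega> x y" "\<omega> x y \<noteq> 0"
  shows "\<exists>a. \<omega> a (J a) \<noteq> 0"
proof (rule ccontr)
  assume "\<not> (\<exists>a. \<omega> a (J a) \<noteq> 0)"
  then have z: "\<omega> a (J a) = 0" for a by blast
  have *: "\<omega> b (J a) = \<omega> a (J b)" for a b
  proof -
    have "\<omega> b (J a) = \<omega> (J b) (J (J a))" using assms(3) by simp
    also have "\<dots> = \<omega> a (J b)"
      using alternating_antisym[OF assms(1,2), where x = a and y = "J b"]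
      by (simp add: JJ bilinear_rneg[OF assms(1)])
    finally show ?thesis .
  qed
  have "\<omega> (x + J y) (J (x + J y)) = 0" by (rule z)
  then have "\<omega> x (J (J y)) + \<omega> (J y) (J x) = 0"
    using z[of x] z[of "J y"]
    by (simp add: linear_add[OF lin] bilinear_ladd[OF assms(1)] bilinear_radd[OF assms(1)] add.commute)
  then have "2 *\<^sub>R \<omega> x (J (J y)) = 0" using * by (simp add: scaleR_2)
  then show False using assms(4) by (simp add: JJ bilinear_rneg[OF assms(1)])
qed

text \<open>Contracting the vanishing square with \<open>a\<close> and \<open>J a\<close> gives
  \<open>\<omega> a (J a)\<close> times \<open>\<omega>\<close> as the wedge of
  \<open>\<omega> a\<close> and \<open>\<omega> (J a)\<close>, and invariance turns the second
  factor into \<open>- (\<omega> a \<circ> J)\<close>.\<close>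

lemma decomposable_invariant_form:
  assumes inv: "invariant_form J \<omega>" and pf: "\<And>x y z w. pfaffian \<omega> x y z w = 0"
  shows "\<exists>c \<gamma>. linear \<gamma> \<and> (\<forall>x y. \<omega> x y = c * wedge \<gamma> (\<gamma> \<circ> J) x y)"
proof (cases "\<forall>x y. \<omega> x y = 0")
  case True
  show ?thesis
    by (rule exI[of _ 0], rule exI[of _ "\<lambda>_. 0"]) (use True in \<open>simp add: linear_zero\<close>)
next
  case False
  have bil: "bilinear \<omega>" and alt: "\<And>x. \<omega> x x = 0" and J: "\<And>x y. \<omega> (J x) (J y) = \<omega> x y"
    using inv by (auto simp: invariant_form_def)
  obtain x y where "\<omega> x y \<noteq> 0" using False by blast
  from invariant_form_nonzero_line[where \<omega> = \<omega>, OF bil alt J this]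
  obtain a where a: "\<omega> a (J a) \<noteq> 0" ..
  have "\<omega> x y = (- 1 / \<omega> a (J a)) * wedge (\<omega> a) (\<omega> a \<circ> J) x y" for x y
    using pf[of a "J a" x y] a invariant_form_J[OF inv, of a]
    by (simp add: pfaffian_def wedge_def field_simps)
  moreover have "linear (\<omega> a)" using bil by (simp add: bilinear_def)
  ultimately show ?thesis by blast
qed

text \<open>For c : s = 1 : t the equation reads p t^2 - q t - p = 0. Since the quadratic form is
  trace-free, the discriminant q^2 + 4 p^2 is never negative.\<close>

lemma rotation_null_direction:
  fixes p q :: real
  obtains c s where "c\<^sup>2 + s\<^sup>2 = 1" "(c\<^sup>2 - s\<^sup>2) * p + c * s * q = 0"
proof (cases "p = 0")
  case True
  then show ?thesis using that[of 1 0] by simp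
next
  case False
  define t where "t = (q + sqrt (q\<^sup>2 + 4 * p\<^sup>2)) / (2 * p)"
  have "(sqrt (q\<^sup>2 + 4 * p\<^sup>2))\<^sup>2 = q\<^sup>2 + 4 * p\<^sup>2" by simp
  then have "p * t\<^sup>2 = p + q * t"
    using False unfolding t_def by (simp add: field_simps power2_eq_square)
  have pos: "1 + t\<^sup>2 > 0" by (simp add: add_pos_nonneg)
  define c where "c = 1 / sqrt (1 + t\<^sup>2)"
  have c2: "c\<^sup>2 * (1 + t\<^sup>2) = 1" using pos by (simp add: c_def power_divide)
  show ?thesis
  proof (rule that[of c "c * t"])
    show "c\<^sup>2 + (c * t)\<^sup>2 = 1" using c2 by (simp add: algebra_simps)
    have "(c\<^sup>2 - (c * t)\<^sup>2) * p + c * (c * t) * q = c\<^sup>2 * (p - p * t\<^sup>2 + q * t)"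
      by (simp add: algebra_simps power2_eq_square)
    then show "(c\<^sup>2 - (c * t)\<^sup>2) * p + c * (c * t) * q = 0"
      using \<open>p * t\<^sup>2 = p + q * t\<close> by simp
  qed
qed

text \<open>If \<open>\<omega>1 \<and> \<omega>1 + \<omega>2 \<and> \<omega>2 = 0\<close> and \<open>\<omega>1\<close> is not decomposable, then both forms live on a common
  complex plane with coframe \<open>e1, \<dots>, e4\<close>, where \<open>\<omega>1 = h e12 + (k\<^sup>2/h) e34\<close> and
  \<open>\<omega>2 = k (e14 - e23) + r e34\<close>. On that plane the square of an invariant form is a quadratic form,
  and a trace-free quadratic form on \<open>\<real>\<^sup>2\<close> has two orthogonal null directions.\<close>

lemma simultaneous_decomposition:
  assumes inv1: "invariant_form J \<omega>1" and inv2: "invariant_form J \<omega>2"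
    and pf: "\<And>x y z w. pfaffian \<omega>1 x y z w + pfaffian \<omega>2 x y z w = 0"
    and A1: "\<omega>1 A (J A) \<noteq> 0" and A2: "\<omega>2 A (J A) = 0"
  shows "\<exists>c s c1 c2 \<gamma>1 \<gamma>2. c\<^sup>2 + s\<^sup>2 = 1 \<and> linear \<gamma>1 \<and> linear \<gamma>2 \<and>
    (\<forall>x y. c * \<omega>1 x y + s * \<omega>2 x y = c1 * wedge \<gamma>1 (\<gamma>1 \<circ> J) x y) \<and>
    (\<forall>x y. c * \<omega>2 x y - s * \<omega>1 x y = c2 * wedge \<gamma>2 (\<gamma>2 \<circ> J) x y)"
proof -
  have witness: ?thesis if "c\<^sup>2 + s\<^sup>2 = 1" "linear \<gamma>1" "linear \<gamma>2"
    "\<And>x y. c * \<omega>1 x y + s * \<omega>2 x y = c1 * wedge \<gamma>1 (\<gamma>1 \<circ> J) x y"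
    "\<And>x y. c * \<omega>2 x y - s * \<omega>1 x y = c2 * wedge \<gamma>2 (\<gamma>2 \<circ> J) x y" for c s c1 c2 \<gamma>1 \<gamma>2
    using that by blast
  have bil1: "bilinear \<omega>1" and alt1: "\<And>x. \<omega>1 x x = 0"
    using inv1 by (auto simp: invariant_form_def)
  have bil2: "bilinear \<omega>2" and alt2: "\<And>x. \<omega>2 x x = 0" and J2: "\<And>x y. \<omega>2 (J x) (J y) = \<omega>2 x y"
    using inv2 by (auto simp: invariant_form_def)
  note JL1 = invariant_form_J[OF inv1] and JL2 = invariant_form_J[OF inv2]
  define h where "h = \<omega>1 A (J A)"
  define \<alpha>1 where "\<alpha>1 = \<omega>1 A"
  define \<alpha>2 where "\<alpha>2 = \<omega>2 A"
  have h: "h \<noteq> 0" using A1 by (simp add: h_def)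
  have lin1: "linear \<alpha>1" and lin2: "linear \<alpha>2"
    using bil1 bil2 by (simp_all add: \<alpha>1_def \<alpha>2_def bilinear_def)
  \<comment> \<open>The relation contracted with \<open>A\<close> and \<open>J A\<close>; as
    \<open>\<omega>2 A (J A) = 0\<close>, the second form enters only through
    \<open>\<alpha>2\<close>.\<close>
  have w1: "h * \<omega>1 x y = - wedge \<alpha>1 (\<alpha>1 \<circ> J) x y - wedge \<alpha>2 (\<alpha>2 \<circ> J) x y" for x y
    using pf[of A "J A" x y] A2
    by (simp add: pfaffian_def wedge_def JL1 JL2 h_def \<alpha>1_def \<alpha>2_def algebra_simps)
  show ?thesis
  \<comment> \<open>If \<open>\<alpha>2\<close> vanishes, \<open>\<omega>1\<close> is already
    decomposable, hence so is \<open>\<omega>2\<close>, and the trivial rotation works.\<close>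
  proof (cases "\<forall>x. \<alpha>2 x = 0")
    case True
    then have "\<omega>1 x y = (- 1 / h) * wedge \<alpha>1 (\<alpha>1 \<circ> J) x y" for x y
      using w1[of x y] h by (simp add: wedge_def field_simps)
    then have w1': "\<omega>1 = (\<lambda>x y. (- 1 / h) * wedge \<alpha>1 (\<alpha>1 \<circ> J) x y)" by blast
    have "pfaffian \<omega>1 x y z w = 0" for x y z w unfolding w1' by (rule pfaffian_wedge)
    then have "pfaffian \<omega>2 x y z w = 0" for x y z w using pf[of x y z w] by simp
    from decomposable_invariant_form[OF inv2 this] obtain c2 \<gamma>2
      where "linear \<gamma>2" "\<And>x y. \<omega>2 x y = c2 * wedge \<gamma>2 (\<gamma>2 \<circ> J) x y" by blast
    then show ?thesis using witness[of 1 0 \<alpha>1 \<gamma>2 "- 1 / h" c2] lin1 w1' by simp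
  next
    case False
    then obtain B0 where B0: "\<alpha>2 B0 \<noteq> 0" by blast
    \<comment> \<open>\<open>B1\<close> is \<open>B0\<close> moved along the complex line of
      \<open>A\<close> into the kernel of \<open>\<alpha>1\<close> and
      \<open>\<alpha>1 \<circ> J\<close>. \<open>B\<close> is a complex multiple of
      \<open>B1\<close> chosen to be killed by \<open>\<alpha>2\<close>, so that only
      \<open>k = \<alpha>2 (J B)\<close> survives.\<close>
    define B1 where "B1 = B0 - (\<alpha>1 (J B0) / h) *\<^sub>R A - (\<alpha>1 B0 / h) *\<^sub>R J A"
    define B where "B = \<alpha>2 (J B1) *\<^sub>R B1 - \<alpha>2 B1 *\<^sub>R J B1"
    define k where "k = \<alpha>2 (J B)"
    define r where "r = \<omega>2 B (J B)"
    note ln = linear_add linear_diff linear_scale linear_neg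
    have \<alpha>A: "\<alpha>1 A = 0" "\<alpha>1 (J A) = h" "\<alpha>2 A = 0" "\<alpha>2 (J A) = 0"
      using alt1 alt2 A2 by (simp_all add: \<alpha>1_def \<alpha>2_def h_def)
    have B1: "\<alpha>1 B1 = 0" "\<alpha>1 (J B1) = 0" "\<alpha>2 B1 = \<alpha>2 B0"
      using h \<alpha>A by (simp_all add: B1_def ln[OF lin1] ln[OF lin2] ln[OF lin] JJ)
    have B: "\<alpha>1 B = 0" "\<alpha>1 (J B) = 0" "\<alpha>2 B = 0"
      using B1 by (simp_all add: B_def ln[OF lin1] ln[OF lin2] ln[OF lin] JJ)
    have "k = (\<alpha>2 (J B1))\<^sup>2 + (\<alpha>2 B1)\<^sup>2"
      by (simp add: k_def B_def ln[OF lin2] ln[OF lin] JJ power2_eq_square)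
    then have k: "k \<noteq> 0" using B0 B1(3) by (simp add: sum_power2_eq_zero_iff)
    \<comment> \<open>The projection onto the complex span of \<open>A\<close> and \<open>B\<close>
      along the common kernel of \<open>\<alpha>1\<close>, \<open>\<alpha>2\<close> and their
      compositions with \<open>J\<close>.\<close>
    define P where "P x = (\<alpha>1 (J x) / h) *\<^sub>R A + (\<alpha>1 x / h) *\<^sub>R J A
        + (\<alpha>2 (J x) / k) *\<^sub>R B + (\<alpha>2 x / k) *\<^sub>R J B" for x
    have kerP: "\<alpha>1 (x - P x) = 0" "\<alpha>1 (J (x - P x)) = 0" "\<alpha>2 (x - P x) = 0" "\<alpha>2 (J (x - P x)) = 0" for x
      using h k \<alpha>A B by (simp_all add: P_def ln[OF lin1] ln[OF lin2] ln[OF lin] JJ k_def[symmetric])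
    \<comment> \<open>The relation makes \<open>\<omega>2 D\<close> proportional both to
      \<open>\<alpha>2\<close> and to \<open>\<alpha>2 \<circ> J\<close>, which \<open>B\<close> and
      \<open>J B\<close> show to be independent.\<close>
    have ker2: "\<omega>2 D y = 0" if D: "\<alpha>1 D = 0" "\<alpha>1 (J D) = 0" "\<alpha>2 D = 0" "\<alpha>2 (J D) = 0" for D y
    proof -
      have D1: "\<omega>1 D z = 0" for z
        using w1[of D z] D h by (simp add: wedge_def)
      have D2: "\<omega>2 D A = 0" "\<omega>2 D (J A) = 0"
        using invariant_form_antisym[OF inv2, of A D] invariant_form_antisym[OF inv2, of "J A" D] D
        by (simp_all add: \<alpha>2_def JL2)
      have A': "\<omega>2 u A = - \<alpha>2 u" "\<omega>2 A u = \<alpha>2 u" "\<omega>2 u (J A) = \<alpha>2 (J u)" "\<omega>2 (J A) u = - \<alpha>2 (J u)" for u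
        using invariant_form_antisym[OF inv2, of u A] invariant_form_antisym[OF inv2, of u "J A"]
        by (simp_all add: \<alpha>2_def JL2)
      have "pfaffian \<omega>2 D u (J A) v = 0" "pfaffian \<omega>2 D u A v = 0" for u v
        using pf[of D u "J A" v] pf[of D u A v] D1 by (simp_all add: pfaffian_def)
      then have e: "\<omega>2 D u * \<alpha>2 (J v) = \<omega>2 D v * \<alpha>2 (J u)" "\<omega>2 D u * \<alpha>2 v = \<omega>2 D v * \<alpha>2 u" for u v
        using D2 by (simp_all add: pfaffian_def A' algebra_simps)
      have "\<omega>2 D B = 0" using e(2)[of "J B" B] B k by (simp add: k_def)
      then show ?thesis using e(1)[of y B] k by (simp add: k_def[symmetric])
    qed
    \<comment> \<open>Hence \<open>\<omega>2\<close> factors through \<open>P\<close> and is read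
      off from its values on \<open>A\<close>, \<open>J A\<close>, \<open>B\<close>,
      \<open>J B\<close>.\<close>
    have r12: "\<omega>2 x y = k * (wedge (\<alpha>1 \<circ> J) \<alpha>2 x y - wedge \<alpha>1 (\<alpha>2 \<circ> J) x y) / (h * k)
        + r * wedge (\<alpha>2 \<circ> J) \<alpha>2 x y / k\<^sup>2" for x y
    proof -
      have "\<omega>2 x y = \<omega>2 (P x) (P y)"
      proof -
        have "\<omega>2 (x - P x) y = 0" "\<omega>2 (y - P y) (P x) = 0" using ker2 kerP by blast+
        then show ?thesis
          using invariant_form_antisym[OF inv2, of y "P x"] invariant_form_antisym[OF inv2, of "P y" "P x"]
          by (simp add: bilinear_lsub[OF bil2])
      qed
      also have "\<dots> = k * (wedge (\<alpha>1 \<circ> J) \<alpha>2 x y - wedge \<alpha>1 (\<alpha>2 \<circ> J) x y) / (h * k)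
        + r * wedge (\<alpha>2 \<circ> J) \<alpha>2 x y / k\<^sup>2"
      proof -
        have vals: "\<omega>2 A A = 0" "\<omega>2 B B = 0" "\<omega>2 (J A) (J A) = 0" "\<omega>2 (J B) (J B) = 0"
          "\<omega>2 A (J A) = 0" "\<omega>2 (J A) A = 0" "\<omega>2 A B = 0" "\<omega>2 B A = 0" "\<omega>2 A (J B) = k" "\<omega>2 (J B) A = - k"
          "\<omega>2 (J A) B = - k" "\<omega>2 B (J A) = k" "\<omega>2 (J A) (J B) = 0" "\<omega>2 (J B) (J A) = 0"
          "\<omega>2 B (J B) = r" "\<omega>2 (J B) B = - r"
          using alt2 A2 B invariant_form_antisym[OF inv2, of A B] invariant_form_antisym[OF inv2, of A "J B"]
            invariant_form_antisym[OF inv2, of "J A" B]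
          by (simp_all add: \<alpha>2_def JL2 J2 k_def r_def JJ bilinear_rneg[OF bil2])
        show ?thesis
          unfolding P_def bilinear_ladd[OF bil2] bilinear_radd[OF bil2] bilinear_lmul[OF bil2]
            bilinear_rmul[OF bil2] vals wedge_def
          using h k by (simp add: field_simps power2_eq_square)
      qed
      finally show ?thesis .
    qed
    \<comment> \<open>(a^2 - b^2) k^2 + a b h r is the \<open>pfaffian\<close> of
      \<open>a \<omega>1 + b \<omega>2\<close> on \<open>A\<close>, \<open>J A\<close>,
      \<open>B\<close>, \<open>J B\<close>. Its coefficients of a^2 and b^2 are opposite, so a zero
      at (c, s) gives one at (-s, c). If \<open>c\<close> or \<open>s\<close> were zero,
      \<open>k\<close> would be zero.\<close>
    obtain c s where cs: "c\<^sup>2 + s\<^sup>2 = 1" and null: "(c\<^sup>2 - s\<^sup>2) * k\<^sup>2 + c * s * (h * r) = 0"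
      by (rule rotation_null_direction)
    have c0: "c \<noteq> 0" and s0: "s \<noteq> 0" using cs null k by auto
    text \<open>Both rotated forms have the shape \<open>p e12 + m (e14 - e23) + (m\<^sup>2/p) e34\<close>, i.e.
      \<open>(1/p) (p e1 + m e3) \<and> (p e2 + m e4)\<close>.\<close>
    have key: "a * \<omega>1 x y + b * \<omega>2 x y
        = (- 1 / (a * h)) * wedge (\<lambda>x. a * \<alpha>1 x + b * \<alpha>2 x) ((\<lambda>x. a * \<alpha>1 x + b * \<alpha>2 x) \<circ> J) x y"
      if "a \<noteq> 0" "(a\<^sup>2 - b\<^sup>2) * k\<^sup>2 + a * b * (h * r) = 0" for a b x y
    proof -
      have w1': "\<omega>1 x y = - (wedge \<alpha>1 (\<alpha>1 \<circ> J) x y + wedge \<alpha>2 (\<alpha>2 \<circ> J) x y) / h"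
        using w1[of x y] h by (simp add: field_simps)
      have r': "b * r = (b\<^sup>2 - a\<^sup>2) * k\<^sup>2 / (a * h)"
        using that h by (simp add: field_simps)
      have "b * \<omega>2 x y = b * (wedge (\<alpha>1 \<circ> J) \<alpha>2 x y - wedge \<alpha>1 (\<alpha>2 \<circ> J) x y) / h
        + (b * r) * wedge (\<alpha>2 \<circ> J) \<alpha>2 x y / k\<^sup>2"
        unfolding r12 using h k by (simp add: field_simps)
      also have "\<dots> = b * (wedge (\<alpha>1 \<circ> J) \<alpha>2 x y - wedge \<alpha>1 (\<alpha>2 \<circ> J) x y) / h
        + (b\<^sup>2 - a\<^sup>2) * wedge (\<alpha>2 \<circ> J) \<alpha>2 x y / (a * h)"
        unfolding r' using h k that(1) by (simp add: field_simps)
      finally show ?thesis unfolding w1'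
        using h that(1) by (simp add: wedge_def field_simps power2_eq_square)
    qed
    have lin': "linear (\<lambda>x. a * \<alpha>1 x + b * \<alpha>2 x)" for a b
      by (rule linearI) (simp_all add: ln[OF lin1] ln[OF lin2] algebra_simps)
    have "((- s)\<^sup>2 - c\<^sup>2) * k\<^sup>2 + (- s) * c * (h * r) = 0"
      using null by (simp add: algebra_simps)
    from key[OF _ this] s0 have "c * \<omega>2 x y - s * \<omega>1 x y = (- 1 / (- s * h)) *
        wedge (\<lambda>x. - s * \<alpha>1 x + c * \<alpha>2 x) ((\<lambda>x. - s * \<alpha>1 x + c * \<alpha>2 x) \<circ> J) x y" for x y
      by (simp add: algebra_simps)
    then show ?thesis
      by (rule witness[OF cs lin' lin' key[OF c0 null]])
  qed
qed

end

subsection \<open>Orthonormal bases and the SKT condition\<close>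

lemma ce_d_3:
  "ce_d br \<omega> [x, y, z] = - \<omega> [br x y, z] + \<omega> [br x z, y] - \<omega> [br y z, x]"
  by (simp add: ce_d_def eval_nat_numeral lessThan_Suc nths_Cons)

lemma ce_d_4:
  "ce_d br \<omega> [x, y, z, w] = - \<omega> [br x y, z, w] + \<omega> [br x z, y, w] - \<omega> [br y z, x, w]
    - \<omega> [br x w, y, z] + \<omega> [br y w, x, z] - \<omega> [br z w, x, y]"
  by (simp add: ce_d_def eval_nat_numeral lessThan_Suc nths_Cons)

text \<open>With \<open>f\<close> written as the inner product with \<open>a\<close>, the extension
  by zero of its restriction is the inner product with the component of \<open>a\<close> in
  \<open>U\<close>.\<close>

lemma dual_space_restrict:
  fixes f :: "'a::euclidean_space \<Rightarrow> real"
  assumes "subspace U" "linear f"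
  obtains g where "g \<in> dual_space U" "\<And>y. y \<in> U \<Longrightarrow> g y = f y"
proof -
  define a where "a = adjoint f 1"
  have fa: "f x = a \<bullet> x" for x
    using adjoint_works[OF assms(2), of x 1] by (simp add: a_def inner_commute)
  obtain u v where "u \<in> span U" and v: "\<And>w. w \<in> span U \<Longrightarrow> orthogonal v w" and auv: "a = u + v"
    using orthogonal_subspace_decomp_exists[of U a] by metis
  then have u: "u \<in> U" using assms(1) span_eq_iff by blast
  show thesis
  proof
    show "(\<lambda>x. u \<bullet> x) \<in> dual_space U"
      using u by (auto simp: dual_space_def orthogonal_comp_def orthogonal_def
          intro: bounded_linear.linear bounded_linear_inner_right)
    show "u \<bullet> y = f y" if "y \<in> U" for y
      using v[of y] that by (simp add: fa auv inner_add_left orthogonal_def span_base)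
  qed
qed

text \<open>A proper subspace has a nonzero normal vector. Surjectivity onto a product thus becomes
  linear independence of the component functionals.\<close>

lemma surj_if_no_annihilator:
  fixes f :: "'a::euclidean_space \<Rightarrow> 'b::euclidean_space"
  assumes "linear f" "\<And>w. (\<And>x. w \<bullet> f x = 0) \<Longrightarrow> w = 0"
  shows "range f = UNIV"
proof (rule ccontr)
  assume "range f \<noteq> UNIV"
  then have "span (range f) \<noteq> UNIV"
    using assms(1) by (simp add: linear_subspace_image span_eq_iff[THEN iffD2])
  then obtain a where "a \<noteq> 0" "span (range f) \<subseteq> {x. a \<bullet> x = 0}"
    using span_not_univ_subset_hyperplane by blast
  then show False using assms(2)[of a] by (metis (mono_tags, lifting) UNIV_I image_eqI mem_Collect_eq span_base subsetD)
qed

section \<open>Orthonormal pairs under rotation, change of sign and exchange\<close>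

context
  fixes V :: "'a::euclidean_space set" and X1 X2 :: 'a
  assumes onb: "orthonormal_basis2 V X1 X2"
begin

lemma onb_inner: "X1 \<bullet> X1 = 1" "X2 \<bullet> X2 = 1" "X1 \<bullet> X2 = 0" "X2 \<bullet> X1 = 0"
  using onb by (auto simp: orthonormal_basis2_def norm_eq_1 inner_commute)

lemma onb_mem: "X1 \<in> V" "X2 \<in> V"
  using onb by (auto simp: orthonormal_basis2_def span_base)

lemma onb_expand:
  assumes "x \<in> V"
  shows "x = (X1 \<bullet> x) *\<^sub>R X1 + (X2 \<bullet> x) *\<^sub>R X2"
proof -
  have "x \<in> span {X1, X2}" using assms onb by (simp add: orthonormal_basis2_def)
  then obtain a b where "x = a *\<^sub>R X1 + b *\<^sub>R X2"
    by (metis (no_types, lifting) diff_add_cancel diff_eq_eq eq_iff_diff_eq_0 insert_absorb2 singletonD span_breakdown_eq span_singleton rangeE add.commute)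
  then show ?thesis by (simp add: inner_add_right onb_inner)
qed

lemma onb_rotate:
  assumes "c\<^sup>2 + s\<^sup>2 = 1"
  shows "orthonormal_basis2 V (c *\<^sub>R X1 + s *\<^sub>R X2) (c *\<^sub>R X2 - s *\<^sub>R X1)"
proof -
  let ?Y1 = "c *\<^sub>R X1 + s *\<^sub>R X2" and ?Y2 = "c *\<^sub>R X2 - s *\<^sub>R X1"
  have "c *\<^sub>R ?Y1 - s *\<^sub>R ?Y2 = (c\<^sup>2 + s\<^sup>2) *\<^sub>R X1" "s *\<^sub>R ?Y1 + c *\<^sub>R ?Y2 = (c\<^sup>2 + s\<^sup>2) *\<^sub>R X2"
    by (simp_all add: algebra_simps power2_eq_square)
  then have "c *\<^sub>R ?Y1 - s *\<^sub>R ?Y2 = X1" "s *\<^sub>R ?Y1 + c *\<^sub>R ?Y2 = X2" using assms by simp_all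
  moreover have "c *\<^sub>R ?Y1 - s *\<^sub>R ?Y2 \<in> span {?Y1, ?Y2}" "s *\<^sub>R ?Y1 + c *\<^sub>R ?Y2 \<in> span {?Y1, ?Y2}"
    by (intro span_add span_diff span_scale span_base; simp)+
  ultimately have "{X1, X2} \<subseteq> span {?Y1, ?Y2}" by simp
  moreover have "{?Y1, ?Y2} \<subseteq> span {X1, X2}"
    by (simp, intro conjI span_add span_diff span_scale span_base; simp)
  ultimately have "span {?Y1, ?Y2} = span {X1, X2}" by (metis span_eq)
  moreover have "?Y1 \<bullet> ?Y1 = 1" "?Y2 \<bullet> ?Y2 = 1" "?Y1 \<bullet> ?Y2 = 0"
    using assms by (simp_all add: inner_add_left inner_add_right inner_diff_left inner_diff_right
        onb_inner power2_eq_square)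
  ultimately show ?thesis
    using onb by (simp add: orthonormal_basis2_def norm_eq_1)
qed

lemma onb_signs:
  assumes "\<bar>e1\<bar> = 1" "\<bar>e2\<bar> = 1"
  shows "orthonormal_basis2 V (e1 *\<^sub>R X1) (e2 *\<^sub>R X2)"
proof -
  have "e1 *\<^sub>R e1 *\<^sub>R X1 \<in> span {e1 *\<^sub>R X1, e2 *\<^sub>R X2}" "e2 *\<^sub>R e2 *\<^sub>R X2 \<in> span {e1 *\<^sub>R X1, e2 *\<^sub>R X2}"
    by (intro span_scale span_base; simp)+
  moreover have "e1 * e1 = 1" "e2 * e2 = 1" using assms by (metis abs_mult_self_eq mult_1)+
  ultimately have "{X1, X2} \<subseteq> span {e1 *\<^sub>R X1, e2 *\<^sub>R X2}" by simp
  moreover have "{e1 *\<^sub>R X1, e2 *\<^sub>R X2} \<subseteq> span {X1, X2}"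
    by (simp, intro conjI span_scale span_base; simp)
  ultimately have "span {e1 *\<^sub>R X1, e2 *\<^sub>R X2} = span {X1, X2}" by (metis span_eq)
  then show ?thesis using onb assms by (simp add: orthonormal_basis2_def)
qed

lemma onb_swap: "orthonormal_basis2 V X2 X1"
  using onb by (simp add: orthonormal_basis2_def inner_commute insert_commute)

end

lemma orthonormal_basis2_exists:
  fixes V :: "'a::euclidean_space set"
  assumes "subspace V" "dim V = 2"
  obtains X1 X2 where "orthonormal_basis2 V X1 X2"
proof -
  obtain B where B: "pairwise orthogonal B" "\<And>x. x \<in> B \<Longrightarrow> norm x = 1" "card B = 2" "span B = V"
    using orthonormal_basis_subspace[OF assms(1)] assms(2) by metis
  then obtain X1 X2 where "B = {X1, X2}" "X1 \<noteq> X2" by (auto simp: card_2_iff)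
  with B have "orthonormal_basis2 V X1 X2"
    by (auto simp: orthonormal_basis2_def pairwise_def orthogonal_def)
  then show thesis by (rule that)
qed

section \<open>Integrability and the SKT condition for a totally real derived algebra\<close>

context almost_hermitian_lie_algebra
begin

lemmas br_add = bilinear_ladd[OF bilinear_br] bilinear_radd[OF bilinear_br]
lemmas br_neg = bilinear_lneg[OF bilinear_br] bilinear_rneg[OF bilinear_br]
lemmas br_scale = bilinear_lmul[OF bilinear_br] bilinear_rmul[OF bilinear_br]
lemmas J_lin = linear_add[OF linear_J] linear_neg[OF linear_J] linear_scale[OF linear_J]
  linear_diff[OF linear_J] linear_0[OF linear_J]

lemma br_antisym: "br y x = - br x y"
  by (rule alternating_antisym[OF bilinear_br br_self])

abbreviation "\<gg>' \<equiv> derived_algebra br"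

lemma subspace_derived: "subspace \<gg>'"
  by (simp add: derived_algebra_def)

lemma br_derived: "br x y \<in> \<gg>'"
  unfolding derived_algebra_def by (rule span_base) blast

lemma inner_J_left: "J x \<bullet> y = - (x \<bullet> J y)"
  using inner_J[of x "J y"] by (simp add: J_J)

lemma inner_self_J: "x \<bullet> J x = 0" "J x \<bullet> x = 0"
  using inner_J_left[of x x] by (simp_all add: inner_commute)

text \<open>Since \<open>\<gg>'\<close> is totally real, the two \<open>\<gg>'\<close>- and \<open>J\<gg>'\<close>-parts of the Nijenhuis tensor vanish
  separately.\<close>

lemma integrable_iff:
  assumes "totally_real J \<gg>'"
  shows "integrable_structure br J \<longleftrightarrow> (\<forall>x y. br (J x) (J y) = br x y)"
proof
  assume int: "integrable_structure br J"
  show "\<forall>x y. br (J x) (J y) = br x y"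
  proof (intro allI)
    fix x y
    let ?v = "br (J x) (J y) - br x y"
    have "?v = J (br (J x) y + br x (J y))"
      using int by (simp add: integrable_structure_def J_lin algebra_simps)
    moreover have "br (J x) y + br x (J y) \<in> \<gg>'" "?v \<in> \<gg>'"
      by (intro subspace_add subspace_diff subspace_derived br_derived)+
    ultimately have "?v = 0" using assms unfolding totally_real_def by blast
    then show "br (J x) (J y) = br x y" by simp
  qed
next
  assume inv: "\<forall>x y. br (J x) (J y) = br x y"
  have "br (J x) y = - br x (J y)" for x y
    using inv[rule_format, of "J x" y] by (simp add: J_J br_neg)
  with inv show "integrable_structure br J"
    by (simp add: integrable_structure_def J_lin)
qed

text \<open>The second condition below is \<open>\<Sum>\<^sub>i \<omega>\<^sub>i \<and> \<omega>\<^sub>i = 0\<close> for the components \<open>\<omega>\<^sub>i\<close> of the bracket with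
  respect to an orthonormal basis of \<open>\<gg>'\<close>.\<close>

lemma SKT_iff:
  assumes "totally_real J \<gg>'"
  shows "SKT br J \<longleftrightarrow> (\<forall>x y. br (J x) (J y) = br x y) \<and>
    (\<forall>x y z w. br x y \<bullet> br z w - br x z \<bullet> br y w + br x w \<bullet> br y z = 0)"
proof -
  let ?c = "pullback J (ce_d br (fundamental_form J))"
  have "(\<forall>Xs. length Xs = 4 \<longrightarrow> ce_d br ?c Xs = 0) \<longleftrightarrow>
      (\<forall>x y z w. br x y \<bullet> br z w - br x z \<bullet> br y w + br x w \<bullet> br y z = 0)"
    if inv: "\<And>x y. br (J x) (J y) = br x y"
  proof -
    have c: "?c [x, y, z] = - (br x y \<bullet> z) + br x z \<bullet> y - br y z \<bullet> x" for x y z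
      by (simp add: pullback_def ce_d_3 fundamental_form_def inv inner_J)
    have dc: "ce_d br ?c [x, y, z, w] =
        2 * (br x y \<bullet> br z w - br x z \<bullet> br y w + br x w \<bullet> br y z)" for x y z w
    proof -
      \<comment> \<open>The double brackets paired with a fixed argument form a Jacobi sum over the
        other three and cancel. Each product of two brackets occurs twice, whence the factor
        2.\<close>
      have jac: "br (br a b) c = br (br a c) b - br (br b c) a" for a b c
        using jacobi[of a b c] br_antisym[of "br a b" c] br_antisym[of "br a c" b]
          br_antisym[of "br b c" a] br_antisym[of c a]
        by (simp add: br_neg algebra_simps add_eq_0_iff)
      show ?thesis
        unfolding ce_d_4 c jac[of x y z] jac[of x y w] jac[of x z w] jac[of y z w]
        by (simp add: inner_diff_left inner_commute algebra_simps)
    qed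
    have "(\<forall>Xs. length Xs = 4 \<longrightarrow> P Xs) \<longleftrightarrow> (\<forall>x y z w. P [x, y, z, w])" for P :: "'a list \<Rightarrow> bool"
      by (auto simp: eval_nat_numeral length_Suc_conv)
    then show ?thesis by (simp only: dc mult_eq_0_iff) simp
  qed
  then show ?thesis
    unfolding SKT_def integrable_iff[OF assms] by blast
qed

lemma component_form:
  assumes "\<And>x y. br (J x) (J y) = br x y"
  shows "invariant_form J (\<lambda>x y. X \<bullet> br x y)"
proof -
  have "bilinear (\<lambda>x y. X \<bullet> br x y)"
    unfolding bilinear_def by (auto intro!: linearI simp: br_add br_scale inner_add_right)
  then show ?thesis by (simp add: invariant_form_def assms br_self)
qed

end

subsection \<open>Decomposing the bracket\<close>

text \<open>Rescaling \<open>\<gamma>\<close> by the square root of |c| leaves only the sign of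
  \<open>c\<close>, which is later moved into the basis vector.\<close>

lemma wedge_normalise:
  fixes \<gamma> :: "'a::real_vector \<Rightarrow> real"
  assumes "linear \<gamma>" "\<And>x y. \<omega> x y = c * wedge \<gamma> (\<gamma> \<circ> J) x y"
  shows "\<exists>e \<alpha>. \<bar>e\<bar> = (1::real) \<and> linear \<alpha> \<and> (\<forall>x y. e * \<omega> x y = wedge \<alpha> (\<alpha> \<circ> J) x y)"
proof (intro exI conjI allI)
  show "\<bar>if c \<ge> 0 then 1 else - 1 :: real\<bar> = 1" by simp
  show "linear (\<lambda>x. sqrt \<bar>c\<bar> * \<gamma> x)"
    by (rule linearI) (simp_all add: linear_add[OF assms(1)] linear_scale[OF assms(1)] algebra_simps)
  have "wedge (\<lambda>x. sqrt \<bar>c\<bar> * \<gamma> x) ((\<lambda>x. sqrt \<bar>c\<bar> * \<gamma> x) \<circ> J) x y = \<bar>c\<bar> * wedge \<gamma> (\<gamma> \<circ> J) x y" for x y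
    using wedge_scale[of "sqrt \<bar>c\<bar>" \<gamma> "sqrt \<bar>c\<bar>" "\<gamma> \<circ> J"] by (simp add: comp_def)
  then show "(if c \<ge> 0 then 1 else - 1) * \<omega> x y
      = wedge (\<lambda>x. sqrt \<bar>c\<bar> * \<gamma> x) ((\<lambda>x. sqrt \<bar>c\<bar> * \<gamma> x) \<circ> J) x y" for x y
    by (simp add: assms(2))
qed

context almost_hermitian_lie_algebra
begin

lemma br_nonzero:
  assumes "dim \<gg>' \<noteq> 0"
  shows "\<exists>x y. br x y \<noteq> 0"
proof (rule ccontr)
  assume "\<not> (\<exists>x y. br x y \<noteq> 0)"
  then have "\<gg>' \<subseteq> {0}"
    unfolding derived_algebra_def by (intro span_minimal) auto
  then show False using assms dim_subset[of \<gg>' "{0}"] by simp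
qed

lemma wedge_J_simps:
  assumes "linear \<gamma>"
  shows "wedge \<gamma> (\<gamma> \<circ> J) (J x) (J y) = wedge \<gamma> (\<gamma> \<circ> J) x y"
  by (simp add: wedge_def J_J linear_neg[OF assms])

lemma bilinear_wedge_J:
  assumes "linear \<gamma>"
  shows "bilinear (\<lambda>x y. (c * wedge \<gamma> (\<gamma> \<circ> J) x y) *\<^sub>R X)"
proof -
  have "bilinear (\<lambda>x y. c * wedge \<gamma> (\<gamma> \<circ> J) x y)"
    unfolding bilinear_def
    by (intro conjI allI linearI)
      (simp_all add: wedge_def linear_add[OF assms] linear_scale[OF assms] J_lin algebra_simps)
  then show ?thesis
    unfolding bilinear_def linear_iff by (simp only: scaleR_left_distrib real_scaleR_def scaleR_scaleR) simp
qed

text \<open>A common form of cases (a) and (b): put \<open>X2 = 0\<close> for (a).\<close>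

definition split_bracket :: "real \<Rightarrow> ('a \<Rightarrow> real) \<Rightarrow> 'a \<Rightarrow> real \<Rightarrow> ('a \<Rightarrow> real) \<Rightarrow> 'a \<Rightarrow> bool" where
  "split_bracket c1 \<gamma>1 X1 c2 \<gamma>2 X2 \<longleftrightarrow> linear \<gamma>1 \<and> linear \<gamma>2 \<and>
    (\<forall>x y. br x y = (c1 * wedge \<gamma>1 (\<gamma>1 \<circ> J) x y) *\<^sub>R X1 + (c2 * wedge \<gamma>2 (\<gamma>2 \<circ> J) x y) *\<^sub>R X2)"

text \<open>Each summand is invariant and has square zero, and orthogonality of \<open>X1\<close>
  and \<open>X2\<close> removes the mixed terms.\<close>

lemma SKT_if_split:
  assumes "split_bracket c1 \<gamma>1 X1 c2 \<gamma>2 X2" "X1 \<bullet> X2 = 0" "totally_real J \<gg>'"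
  shows "SKT br J"
proof -
  have lin: "linear \<gamma>1" "linear \<gamma>2"
    and br: "\<And>x y. br x y = (c1 * wedge \<gamma>1 (\<gamma>1 \<circ> J) x y) *\<^sub>R X1 + (c2 * wedge \<gamma>2 (\<gamma>2 \<circ> J) x y) *\<^sub>R X2"
    using assms(1) by (auto simp: split_bracket_def)
  define \<omega>1 where "\<omega>1 = (\<lambda>x y. c1 * wedge \<gamma>1 (\<gamma>1 \<circ> J) x y)"
  define \<omega>2 where "\<omega>2 = (\<lambda>x y. c2 * wedge \<gamma>2 (\<gamma>2 \<circ> J) x y)"
  have br': "br x y = \<omega>1 x y *\<^sub>R X1 + \<omega>2 x y *\<^sub>R X2" for x y
    by (simp add: br \<omega>1_def \<omega>2_def)
  have "br x y \<bullet> br z w = (\<omega>1 x y * \<omega>1 z w) * (X1 \<bullet> X1) + (\<omega>2 x y * \<omega>2 z w) * (X2 \<bullet> X2)" for x y z w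
    using assms(2) by (simp add: br' inner_add_left inner_add_right inner_commute)
  then have "br x y \<bullet> br z w - br x z \<bullet> br y w + br x w \<bullet> br y z
      = pfaffian \<omega>1 x y z w * (X1 \<bullet> X1) + pfaffian \<omega>2 x y z w * (X2 \<bullet> X2)" for x y z w
    by (simp add: pfaffian_def algebra_simps)
  moreover have "pfaffian \<omega>1 x y z w = 0" "pfaffian \<omega>2 x y z w = 0" for x y z w
    unfolding \<omega>1_def \<omega>2_def by (rule pfaffian_wedge)+
  ultimately show ?thesis
    unfolding SKT_iff[OF assms(3)] by (simp add: br wedge_J_simps[OF lin(1)] wedge_J_simps[OF lin(2)])
qed

lemma split_bracket_dim1:
  assumes "SKT br J" "totally_real J \<gg>'" "dim \<gg>' = 1"
  obtains X \<alpha> where "X \<in> \<gg>'" "norm X = 1" "linear \<alpha>" "\<And>x y. br x y = wedge \<alpha> (\<alpha> \<circ> J) x y *\<^sub>R X"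
proof -
  have inv: "\<And>x y. br (J x) (J y) = br x y"
    and Q: "\<And>x y z w. br x y \<bullet> br z w - br x z \<bullet> br y w + br x w \<bullet> br y z = 0"
    using assms(1) SKT_iff[OF assms(2)] by auto
  obtain B where B: "B \<subseteq> \<gg>'" "\<And>x. x \<in> B \<Longrightarrow> norm x = 1" "card B = 1" "span B = \<gg>'"
    using orthonormal_basis_subspace[OF subspace_derived] assms(3) by metis
  then obtain X where X: "X \<in> \<gg>'" "norm X = 1" "span {X} = \<gg>'" by (auto simp: card_1_singleton_iff)
  have XX: "X \<bullet> X = 1" using X(2) by (simp add: norm_eq_1)
  have br: "br x y = (X \<bullet> br x y) *\<^sub>R X" for x y
    using br_derived[of x y] by (auto simp: X(3)[symmetric] span_singleton XX)
  have "pfaffian (\<lambda>x y. X \<bullet> br x y) x y z w = 0" for x y z w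
  proof -
    have "br x y \<bullet> br z w = (X \<bullet> br x y) * (X \<bullet> br z w)" for x y z w
      by (subst br, subst br[of z]) (simp add: XX)
    then show ?thesis using Q[of x y z w] by (simp add: pfaffian_def)
  qed
  then obtain c \<gamma> where "linear \<gamma>" "\<And>x y. X \<bullet> br x y = c * wedge \<gamma> (\<gamma> \<circ> J) x y"
    using decomposable_invariant_form[OF linear_J J_J component_form[OF inv]] by metis
  from wedge_normalise[of \<gamma> "\<lambda>x y. X \<bullet> br x y", OF this]
  obtain e \<alpha> where e: "\<bar>e\<bar> = 1" and \<alpha>: "linear \<alpha>" "\<And>x y. e * (X \<bullet> br x y) = wedge \<alpha> (\<alpha> \<circ> J) x y"
    by blast
  have "e * e = 1" using e by (metis abs_mult_self_eq mult_1)
  then have "wedge \<alpha> (\<alpha> \<circ> J) x y *\<^sub>R e *\<^sub>R X = (X \<bullet> br x y) *\<^sub>R X" for x y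
    by (simp add: mult.commute mult.left_commute flip: \<alpha>(2))
  then have "br x y = wedge \<alpha> (\<alpha> \<circ> J) x y *\<^sub>R e *\<^sub>R X" for x y
    using br by metis
  then show thesis
    using that[of "e *\<^sub>R X" \<alpha>] X e \<alpha>(1) subspace_scale[OF subspace_derived] by simp
qed

lemma split_bracket_dim2:
  assumes "SKT br J" "totally_real J \<gg>'" "dim \<gg>' = 2"
  obtains X1 X2 \<alpha>1 \<alpha>2 where "orthonormal_basis2 \<gg>' X1 X2" "split_bracket 1 \<alpha>1 X1 1 \<alpha>2 X2"
proof -
  have inv: "\<And>x y. br (J x) (J y) = br x y"
    and Q: "\<And>x y z w. br x y \<bullet> br z w - br x z \<bullet> br y w + br x w \<bullet> br y z = 0"
    using assms(1) SKT_iff[OF assms(2)] by auto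
  note form = component_form[OF inv]
  obtain Z1 Z2 where Z: "orthonormal_basis2 \<gg>' Z1 Z2"
    by (rule orthonormal_basis2_exists[OF subspace_derived assms(3)])
  obtain x y where xy: "br x y \<bullet> br x y \<noteq> 0" using br_nonzero assms(3) by force
  \<comment> \<open>Paired with the nonzero vector \<open>br x y\<close>, the bracket becomes a
    scalar invariant form that is nonzero at \<open>x\<close>, \<open>y\<close>.\<close>
  have "\<exists>A. br x y \<bullet> br A (J A) \<noteq> 0"
    by (rule invariant_form_nonzero_line[OF linear_J J_J, of "\<lambda>u v. br x y \<bullet> br u v", OF _ _ _ xy])
      (use form[of "br x y"] in \<open>simp_all add: invariant_form_def\<close>)
  then obtain A where A: "br A (J A) \<noteq> 0" by force
  \<comment> \<open>Turning the basis so that \<open>Y1\<close> points along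
    \<open>br A (J A)\<close> provides the two conditions on \<open>A\<close> from which the
    simultaneous decomposition starts.\<close>
  let ?w = "br A (J A)"
  define a b where "a = Z1 \<bullet> ?w" and "b = Z2 \<bullet> ?w"
  have w: "?w = a *\<^sub>R Z1 + b *\<^sub>R Z2"
    unfolding a_def b_def by (rule onb_expand[OF Z br_derived])
  have "?w \<bullet> ?w = a\<^sup>2 + b\<^sup>2"
    by (subst (2) w) (simp add: inner_add_right a_def b_def power2_eq_square inner_commute)
  then have n: "(norm ?w)\<^sup>2 = a\<^sup>2 + b\<^sup>2" by (simp add: power2_norm_eq_inner)
  define N where "N = norm ?w"
  have N: "N \<noteq> 0" "N\<^sup>2 = a\<^sup>2 + b\<^sup>2" using A n by (simp_all add: N_def)
  have "(a / N)\<^sup>2 + (b / N)\<^sup>2 = 1" using N by (simp add: power_divide flip: add_divide_distrib N(2))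
  note rot = onb_rotate[OF Z this]
  define Y1 where "Y1 = (a / N) *\<^sub>R Z1 + (b / N) *\<^sub>R Z2"
  define Y2 where "Y2 = (a / N) *\<^sub>R Z2 - (b / N) *\<^sub>R Z1"
  have Y: "orthonormal_basis2 \<gg>' Y1 Y2" using rot by (simp add: Y1_def Y2_def)
  have "Y1 \<bullet> ?w = N" "Y2 \<bullet> ?w = 0"
    using N by (simp_all add: Y1_def Y2_def inner_add_left inner_diff_left field_simps power2_eq_square
        flip: a_def b_def)
  then have Yw: "Y1 \<bullet> ?w \<noteq> 0" "Y2 \<bullet> ?w = 0" using N by auto
  have inner_br: "br x y \<bullet> br z w = (Y1 \<bullet> br x y) * (Y1 \<bullet> br z w) + (Y2 \<bullet> br x y) * (Y2 \<bullet> br z w)" for x y z w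
    by (subst onb_expand[OF Y br_derived[of x y]]) (simp add: inner_add_left)
  have "pfaffian (\<lambda>x y. Y1 \<bullet> br x y) x y z w + pfaffian (\<lambda>x y. Y2 \<bullet> br x y) x y z w = 0" for x y z w
    using Q[of x y z w] unfolding inner_br by (simp add: pfaffian_def)
  from simultaneous_decomposition[of J "\<lambda>x y. Y1 \<bullet> br x y" "\<lambda>x y. Y2 \<bullet> br x y" A,
      OF linear_J J_J form form this Yw]
  obtain c s c1 c2 \<gamma>1 \<gamma>2 where cs: "c\<^sup>2 + s\<^sup>2 = 1" and lin: "linear \<gamma>1" "linear \<gamma>2"
    and \<gamma>1: "\<And>x y. c * (Y1 \<bullet> br x y) + s * (Y2 \<bullet> br x y) = c1 * wedge \<gamma>1 (\<gamma>1 \<circ> J) x y"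
    and \<gamma>2: "\<And>x y. c * (Y2 \<bullet> br x y) - s * (Y1 \<bullet> br x y) = c2 * wedge \<gamma>2 (\<gamma>2 \<circ> J) x y"
    by blast
  define W1 where "W1 = c *\<^sub>R Y1 + s *\<^sub>R Y2"
  define W2 where "W2 = c *\<^sub>R Y2 - s *\<^sub>R Y1"
  have W: "orthonormal_basis2 \<gg>' W1 W2" using onb_rotate[OF Y cs] by (simp add: W1_def W2_def)
  have "W1 \<bullet> br x y = c1 * wedge \<gamma>1 (\<gamma>1 \<circ> J) x y" "W2 \<bullet> br x y = c2 * wedge \<gamma>2 (\<gamma>2 \<circ> J) x y" for x y
    by (simp_all add: W1_def W2_def inner_add_left inner_diff_left flip: \<gamma>1 \<gamma>2)
  note norm1 = wedge_normalise[of \<gamma>1 "\<lambda>x y. W1 \<bullet> br x y", OF lin(1) this(1)]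
    and norm2 = wedge_normalise[of \<gamma>2 "\<lambda>x y. W2 \<bullet> br x y", OF lin(2) this(2)]
  obtain e1 \<alpha>1 where 1: "\<bar>e1\<bar> = 1" "linear \<alpha>1" "\<And>x y. e1 * (W1 \<bullet> br x y) = wedge \<alpha>1 (\<alpha>1 \<circ> J) x y"
    using norm1 by blast
  obtain e2 \<alpha>2 where 2: "\<bar>e2\<bar> = 1" "linear \<alpha>2" "\<And>x y. e2 * (W2 \<bullet> br x y) = wedge \<alpha>2 (\<alpha>2 \<circ> J) x y"
    using norm2 by blast
  note e = 1(1) 2(1) and \<alpha> = 1(2) 2(2) 1(3) 2(3)
  have X: "orthonormal_basis2 \<gg>' (e1 *\<^sub>R W1) (e2 *\<^sub>R W2)" by (rule onb_signs[OF W e])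
  have "split_bracket 1 \<alpha>1 (e1 *\<^sub>R W1) 1 \<alpha>2 (e2 *\<^sub>R W2)"
    unfolding split_bracket_def
  proof (intro conjI \<alpha> allI)
    fix x y
    show "br x y = (1 * wedge \<alpha>1 (\<alpha>1 \<circ> J) x y) *\<^sub>R e1 *\<^sub>R W1 + (1 * wedge \<alpha>2 (\<alpha>2 \<circ> J) x y) *\<^sub>R e2 *\<^sub>R W2"
      using onb_expand[OF X br_derived, of x y] by (simp flip: \<alpha>(3,4))
  qed
  with X show thesis by (rule that)
qed

text \<open>Complex independence of \<open>\<alpha>\<close>, \<open>\<beta>\<close> is real
  independence of the four forms \<open>\<alpha>\<close>, \<open>\<alpha> \<circ> J\<close>,
  \<open>\<beta>\<close>, \<open>\<beta> \<circ> J\<close>, which are therefore jointly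
  onto.\<close>

lemma complex_independent_separates:
  assumes "linear \<alpha>" "linear \<beta>" "complex_independent J \<alpha> \<beta>"
  obtains x where "\<alpha> x = a" "\<alpha> (J x) = b" "\<beta> x = c" "\<beta> (J x) = d"
proof -
  let ?F = "\<lambda>x. (\<alpha> x, \<alpha> (J x), \<beta> x, \<beta> (J x))"
  have "range ?F = UNIV"
  proof (rule surj_if_no_annihilator)
    show "linear ?F"
      by (rule linearI) (simp_all add: linear_add[OF assms(1)] linear_add[OF assms(2)]
          linear_scale[OF assms(1)] linear_scale[OF assms(2)] J_lin)
    fix w :: "real \<times> real \<times> real \<times> real"
    assume w: "\<And>x. w \<bullet> ?F x = 0"
    obtain p q r s where wd: "w = (p, q, r, s)" by (metis prod.exhaust)
    have "cscale J (Complex p q) \<alpha> x + cscale J (Complex r s) \<beta> x = 0" for x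
      using w[of x] by (simp add: wd cscale_def)
    then have "Complex p q = 0 \<and> Complex r s = 0"
      using assms(3) unfolding complex_independent_def by blast
    then show "w = 0" by (simp add: wd complex_eq_iff zero_prod_def)
  qed
  then have "(a, b, c, d) \<in> range ?F" by (simp only: UNIV_I)
  then obtain x where "(a, b, c, d) = ?F x" by (rule rangeE)
  then show thesis using that by simp
qed

text \<open>If one form were a complex multiple u of the other, its wedge square would be |u|^2
  times that of the other, and all brackets would lie on a single line.\<close>

lemma split_bracket_independent:
  assumes "split_bracket 1 \<alpha>1 X1 1 \<alpha>2 X2" "dim \<gg>' = 2"
  shows "complex_independent J \<alpha>1 \<alpha>2"
proof -
  have lin: "linear \<alpha>1" "linear \<alpha>2"
    and br: "\<And>x y. br x y = wedge \<alpha>1 (\<alpha>1 \<circ> J) x y *\<^sub>R X1 + wedge \<alpha>2 (\<alpha>2 \<circ> J) x y *\<^sub>R X2"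
    using assms(1) by (auto simp: split_bracket_def)
  have dep: "wedge \<beta> (\<beta> \<circ> J) x y = ((norm u)\<^sup>2 :: real) * wedge \<alpha> (\<alpha> \<circ> J) x y"
    if "linear \<alpha>" "\<And>x. \<beta> x = cscale J u \<alpha> x" for \<alpha> \<beta> u x y
  proof -
    have b: "\<beta> x = Re u * \<alpha> x + Im u * \<alpha> (J x)" "\<beta> (J x) = Re u * \<alpha> (J x) - Im u * \<alpha> x" for x
      by (simp_all add: that(2) cscale_def J_J linear_neg[OF that(1)])
    show ?thesis unfolding wedge_def cmod_power2 comp_def b(1)[of x] b(1)[of y] b(2)[of x] b(2)[of y] by algebra
  qed
  have solve: "\<exists>u. \<forall>x. \<beta> x = cscale J u \<alpha> x"
    if "linear \<alpha>" "linear \<beta>" "\<And>x. cscale J z \<alpha> x + cscale J w \<beta> x = 0" "w \<noteq> 0" for \<alpha> \<beta> z w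
  proof (intro exI allI)
    fix x
    have n: "(Re w)\<^sup>2 + (Im w)\<^sup>2 \<noteq> 0" using that(4) by (simp add: complex_eq_iff sum_power2_eq_zero_iff)
    \<comment> \<open>Since composition with \<open>J\<close> acts as i, this combination multiplies
      the relation by the conjugate of \<open>w\<close>.\<close>
    have "Re w * (cscale J z \<alpha> x + cscale J w \<beta> x) - Im w * (cscale J z \<alpha> (J x) + cscale J w \<beta> (J x)) = 0"
      by (simp add: that(3))
    then have "((Re w)\<^sup>2 + (Im w)\<^sup>2) * \<beta> x
        = - (Re w * Re z + Im w * Im z) * \<alpha> x - (Re w * Im z - Im w * Re z) * \<alpha> (J x)"
      by (simp add: cscale_def J_J linear_neg[OF that(1)] linear_neg[OF that(2)] algebra_simps power2_eq_square)
    moreover have "((Re w)\<^sup>2 + (Im w)\<^sup>2) * Re (- z / w) = - Re z * Re w - Im z * Im w"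
      "((Re w)\<^sup>2 + (Im w)\<^sup>2) * Im (- z / w) = Re z * Im w - Im z * Re w"
      using n by (simp_all only: Re_divide Im_divide uminus_complex.sel nonzero_mult_div_cancel_left
          times_divide_eq_right) simp_all
    ultimately have "((Re w)\<^sup>2 + (Im w)\<^sup>2) * \<beta> x = ((Re w)\<^sup>2 + (Im w)\<^sup>2) * cscale J (- z / w) \<alpha> x"
      unfolding cscale_def comp_def by algebra
    then show "\<beta> x = cscale J (- z / w) \<alpha> x"
      using n mult_left_cancel by blast
  qed
  have no_line: False if "\<And>x y. br x y \<in> span {Y}" for Y
  proof -
    have "\<gg>' \<subseteq> span {Y}" unfolding derived_algebra_def using that by (intro span_minimal) auto
    then have "dim \<gg>' \<le> dim {Y}" by (metis dim_subset dim_span)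
    then show False using assms(2) dim_le_card'[of "{Y}"] by simp
  qed
  show ?thesis
    unfolding complex_independent_def
  proof (intro allI impI)
    fix z w
    assume *: "\<forall>x. cscale J z \<alpha>1 x + cscale J w \<alpha>2 x = 0"
    show "z = 0 \<and> w = 0"
    proof (rule ccontr)
      assume "\<not> (z = 0 \<and> w = 0)"
      then consider "w \<noteq> 0" | "z \<noteq> 0" by blast
      then show False
      proof cases
        case 1
        then obtain u where "\<forall>x. \<alpha>2 x = cscale J u \<alpha>1 x" using solve[OF lin, of z w] * by blast
        then have "br x y = wedge \<alpha>1 (\<alpha>1 \<circ> J) x y *\<^sub>R (X1 + (norm u)\<^sup>2 *\<^sub>R X2)" for x y
          using dep[OF lin(1), of \<alpha>2 u] by (simp add: br algebra_simps)
        then show False using no_line[of "X1 + (norm u)\<^sup>2 *\<^sub>R X2"] by (simp add: span_base span_scale)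
      next
        case 2
        then obtain u where "\<forall>x. \<alpha>1 x = cscale J u \<alpha>2 x"
          using solve[OF lin(2,1), of w z] * by (metis add.commute)
        then have "br x y = wedge \<alpha>2 (\<alpha>2 \<circ> J) x y *\<^sub>R ((norm u)\<^sup>2 *\<^sub>R X1 + X2)" for x y
          using dep[OF lin(2), of \<alpha>1 u] by (simp add: br algebra_simps)
        then show False using no_line[of "(norm u)\<^sup>2 *\<^sub>R X1 + X2"] by (simp add: span_base span_scale)
      qed
    qed
  qed
qed

lemma split_bracket_swap: "split_bracket c1 \<gamma>1 X1 c2 \<gamma>2 X2 \<longleftrightarrow> split_bracket c2 \<gamma>2 X2 c1 \<gamma>1 X1"
  by (auto simp: split_bracket_def add.commute)

text \<open>The Jacobi identity, evaluated on vectors dual to \<open>\<alpha>1\<close> (or \<open>\<alpha>1 \<circ> J\<close>), \<open>\<alpha>2\<close>, \<open>\<alpha>2 \<circ> J\<close>.\<close>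

lemma split_bracket_cross:
  assumes "split_bracket 1 \<alpha>1 X1 1 \<alpha>2 X2" "complex_independent J \<alpha>1 \<alpha>2"
    and onb: "orthonormal_basis2 \<gg>' X1 X2"
  shows "\<alpha>1 X2 = 0" "\<alpha>1 (J X2) = 0"
proof -
  have lin: "linear \<alpha>1" "linear \<alpha>2"
    and br: "\<And>x y. br x y = wedge \<alpha>1 (\<alpha>1 \<circ> J) x y *\<^sub>R X1 + wedge \<alpha>2 (\<alpha>2 \<circ> J) x y *\<^sub>R X2"
    using assms(1) by (auto simp: split_bracket_def)
  obtain B where B: "\<alpha>1 B = 0" "\<alpha>1 (J B) = 0" "\<alpha>2 B = 1" "\<alpha>2 (J B) = 0"
    using complex_independent_separates[OF lin assms(2)] by metis
  obtain C where C: "\<alpha>1 C = 0" "\<alpha>1 (J C) = 0" "\<alpha>2 C = 0" "\<alpha>2 (J C) = 1"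
    using complex_independent_separates[OF lin assms(2)] by metis
  \<comment> \<open>Such an \<open>A\<close> commutes with \<open>B\<close> and \<open>C\<close>,
    while \<open>br B C = X2\<close>; the Jacobi identity leaves only
    \<open>br A X2\<close>.\<close>
  have "X1 \<bullet> br A X2 = 0" if "\<alpha>2 A = 0" "\<alpha>2 (J A) = 0" for A
  proof -
    have "br B C = X2" "br C A = 0" "br A B = 0"
      using B C that by (simp_all add: br wedge_def)
    then show ?thesis using jacobi[of A B C] by (simp add: bilinear_rzero[OF bilinear_br])
  qed
  then have *: "wedge \<alpha>1 (\<alpha>1 \<circ> J) A X2 = 0" if "\<alpha>2 A = 0" "\<alpha>2 (J A) = 0" for A
    using that onb_inner[OF onb] by (simp add: br inner_add_right)
  obtain A where A: "\<alpha>1 A = 1" "\<alpha>1 (J A) = 0" "\<alpha>2 A = 0" "\<alpha>2 (J A) = 0"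
    using complex_independent_separates[OF lin assms(2)] by metis
  obtain A' where A': "\<alpha>1 A' = 0" "\<alpha>1 (J A') = 1" "\<alpha>2 A' = 0" "\<alpha>2 (J A') = 0"
    using complex_independent_separates[OF lin assms(2)] by metis
  show "\<alpha>1 X2 = 0" using *[of A'] A' by (simp add: wedge_def)
  show "\<alpha>1 (J X2) = 0" using *[of A] A by (simp add: wedge_def)
qed

end

subsection \<open>Splitting off an Abelian factor\<close>

lemma sum_fun_apply: "(\<Sum>i\<in>A. f i) x = (\<Sum>i\<in>A. f i x)"
  for f :: "'i \<Rightarrow> 'x \<Rightarrow> 'b::comm_monoid_add"
  by (induction A rule: infinite_finite_induct) simp_all

lemma subspace_coordinates:
  fixes K :: "'a::euclidean_space set"
  assumes "subspace K"
  obtains \<phi> :: "'a \<Rightarrow> nat \<Rightarrow> real"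
    where "linear \<phi>" "bij_betw \<phi> K {y. \<forall>i\<ge>dim K. y i = 0}"
proof -
  let ?E = "{y :: nat \<Rightarrow> real. \<forall>i\<ge>dim K. y i = 0}"
  define e where "e i = (\<lambda>j. if j = i then 1 else 0 :: real)" for i :: nat
  obtain B where B: "B \<subseteq> K" "independent B" "K \<subseteq> span B" "card B = dim K"
    by (rule basis_exists)
  then have spanB: "span B = K" using assms by (metis span_subspace)
  obtain b where b: "bij_betw b {..<dim K} B"
    using ex_bij_betw_nat_finite[OF independent_imp_finite[OF B(2)]] B(4)
    by (auto simp: atLeast0LessThan)
  then obtain \<phi> where lin: "linear \<phi>" and \<phi>: "\<And>v. v \<in> B \<Longrightarrow> \<phi> v = e (inv_into {..<dim K} b v)"
    using linear_independent_extend[OF B(2), of "\<lambda>v. e (inv_into {..<dim K} b v)"] by blast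
  have \<phi>b: "\<phi> (b i) = e i" if "i < dim K" for i
    using that b \<phi>[of "b i"] by (simp add: bij_betw_apply bij_betw_inv_into_left)
  define \<psi> where "\<psi> y = (\<Sum>i<dim K. y i *\<^sub>R b i)" for y
  have lin\<psi>: "linear \<psi>"
    by (rule linearI)
      (simp_all add: \<psi>_def scaleR_fun_def scaleR_add_left sum.distrib scaleR_sum_right)
  have \<psi>e: "\<psi> (e i) = b i" if "i < dim K" for i
    using that by (simp add: \<psi>_def e_def if_distrib[of "\<lambda>c. c *\<^sub>R _"] cong: if_cong)
  have "bij_betw \<phi> K ?E"
  proof (rule bij_betw_byWitness[where f' = \<psi>])
    show "\<forall>x\<in>K. \<psi> (\<phi> x) = x"
    proof
      fix x assume "x \<in> K"
      then have "x \<in> span B" using spanB by simp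
      moreover have "linear (\<psi> \<circ> \<phi>)" using lin lin\<psi> by (rule linear_compose)
      moreover have "(\<psi> \<circ> \<phi>) v = id v" if "v \<in> B" for v
      proof -
        have "v \<in> b ` {..<dim K}" using that b by (simp add: bij_betw_imp_surj_on)
        then obtain i where "i < dim K" "v = b i" by blast
        then show ?thesis by (simp add: \<phi>b \<psi>e)
      qed
      ultimately show "\<psi> (\<phi> x) = x" using linear_eq_on[of "\<psi> \<circ> \<phi>" id] linear_id by fastforce
    qed
    show "\<forall>y\<in>?E. \<phi> (\<psi> y) = y"
    proof
      fix y assume y: "y \<in> ?E"
      have "\<phi> (\<psi> y) = (\<Sum>i<dim K. y i *\<^sub>R e i)"
        by (simp add: \<psi>_def linear_sum[OF lin] linear_scale[OF lin] \<phi>b)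
      also have "\<dots> = y"
      proof
        fix j
        have "(\<Sum>i<dim K. y i *\<^sub>R e i) j = (\<Sum>i<dim K. if i = j then y i else 0)"
          unfolding sum_fun_apply scaleR_fun_def e_def by (rule sum.cong) auto
        also have "\<dots> = y j" using y by auto
        finally show "(\<Sum>i<dim K. y i *\<^sub>R e i) j = y j" .
      qed
      finally show "\<phi> (\<psi> y) = y" .
    qed
    have "subspace ?E" by (simp add: subspace_def scaleR_fun_def)
    moreover have "\<phi> ` B \<subseteq> ?E"
    proof -
      have "\<phi> v \<in> ?E" if "v \<in> B" for v
      proof -
        have "v \<in> b ` {..<dim K}" using that b by (simp add: bij_betw_imp_surj_on)
        then obtain i where "i < dim K" "v = b i" by blast
        then show ?thesis by (auto simp: \<phi>b e_def)
      qed
      then show ?thesis by blast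
    qed
    ultimately have "span (\<phi> ` B) \<subseteq> ?E" by (simp add: span_minimal)
    then show "\<phi> ` K \<subseteq> ?E" using linear_span_image[OF lin, of B] spanB by simp
    show "\<psi> ` ?E \<subseteq> K"
      using assms B(1) b
      by (auto simp: \<psi>_def intro!: subspace_sum subspace_scale dest: bij_betwE)
  qed
  with lin show thesis by (rule that)
qed

text \<open>\<open>F\<close> maps the orthogonal complement \<open>P\<close> of its kernel
  bijectively onto the target. In particular \<open>DIM('b)\<close> is at most
  \<open>DIM('a)\<close>, so the subtraction of naturals is exact.\<close>

lemma dim_kernel:
  fixes F :: "'a::euclidean_space \<Rightarrow> 'b::euclidean_space"
  assumes lin: "linear F" and "range F = UNIV"
  shows "dim {x. F x = 0} = DIM('a) - DIM('b)"
proof -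
  let ?K = "{x. F x = 0}"
  have K: "subspace ?K" using lin by (rule linear_subspace_kernel)
  define P where "P = {y \<in> UNIV. \<forall>x\<in>?K. orthogonal x y}"
  have dims: "dim P + dim ?K = DIM('a)"
    unfolding P_def by (subst dim_subspace_orthogonal_to_vectors[OF K]) simp_all
  have P: "subspace P"
    by (auto simp: P_def subspace_def orthogonal_def inner_add_right)
  have "x = y" if "x \<in> P" "y \<in> P" "F x = F y" for x y
  proof -
    have "x - y \<in> ?K" using that(3) by (simp add: linear_diff[OF lin])
    moreover have "x - y \<in> P" using P that by (simp add: subspace_diff)
    ultimately have "orthogonal (x - y) (x - y)" by (simp add: P_def)
    then show ?thesis by (simp add: orthogonal_self)
  qed
  moreover have "span P = P" using P span_eq_iff by blast
  ultimately have "inj_on F (span P)" by (metis inj_onI)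
  then have "dim (F ` P) = dim P" using dim_image_eq[OF lin] by blast
  moreover have "F ` P = UNIV"
  proof -
    have "F x \<in> F ` P" for x
    proof -
      obtain y z where "y \<in> span ?K" and z: "\<And>w. w \<in> span ?K \<Longrightarrow> orthogonal z w" and "x = y + z"
        using orthogonal_subspace_decomp_exists[of ?K x] by metis
      then have "F x = F z" using span_eq_iff[THEN iffD2, OF K] by (simp add: linear_add[OF lin])
      moreover have "z \<in> P" using z by (simp add: P_def orthogonal_commute span_base)
      ultimately show ?thesis by blast
    qed
    then show ?thesis using assms(2) by (metis UNIV_eq_I rangeE UNIV_I)
  qed
  ultimately show ?thesis using dims by simp
qed

text \<open>\<open>F\<close> carries a basis of \<open>D\<close> to an independent set. Extending
  that to a basis of the target and lifting it, with the old basis vectors as preimages where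
  possible, defines \<open>s\<close>.\<close>

lemma section_fixing_subspace:
  fixes F :: "'a::euclidean_space \<Rightarrow> 'b::euclidean_space"
  assumes lin: "linear F" and "range F = UNIV" and "subspace D" "\<And>x. x \<in> D \<Longrightarrow> F x = 0 \<Longrightarrow> x = 0"
  obtains s where "linear s" "\<And>w. F (s w) = w" "\<And>x. x \<in> D \<Longrightarrow> s (F x) = x"
proof -
  have D: "span D = D" using assms(3) span_eq_iff by blast
  have inj: "inj_on F D"
    using assms(3,4) by (subst linear_inj_on_iff_eq_0[OF lin]) auto
  obtain C where C: "C \<subseteq> D" "independent C" "D \<subseteq> span C"
    using basis_exists[of D] by metis
  have spanC: "span C = D" using C assms(3) by (metis span_subspace)
  have "independent (F ` C)"
    using linear_independent_injective_image[OF lin C(2)] inj spanC by simp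
  then obtain E where E: "F ` C \<subseteq> E" "independent E" "UNIV \<subseteq> span E"
    using maximal_independent_subset_extend[of "F ` C" UNIV] by (metis subset_UNIV)
  define h where "h e = (if e \<in> F ` C then inv_into C F e else inv F e)" for e
  have h: "F (h e) = e" for e
    using assms(2) by (simp add: h_def f_inv_into_f)
  have hC: "h (F c) = c" if "c \<in> C" for c
    using that inj C(1) by (simp add: h_def inj_on_subset)
  obtain s where s: "linear s" "\<And>e. e \<in> E \<Longrightarrow> s e = h e"
    using linear_independent_extend[OF E(2), of h] by blast
  show thesis
  proof (rule that[OF s(1)])
    show "F (s w) = w" for w
    proof -
      have "(F \<circ> s) w = id w"
        using linear_eq_on[OF linear_compose[OF s(1) lin] linear_id, of w E] E(3) s(2) h by auto
      then show ?thesis by simp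
    qed
    show "s (F x) = x" if "x \<in> D" for x
    proof -
      have "(s \<circ> F) x = id x"
        using linear_eq_on[OF linear_compose[OF lin s(1)] linear_id, of x C] that spanC E(1) s(2) hC
        by (metis comp_apply id_apply image_eqI subsetD)
      then show ?thesis by simp
    qed
  qed
qed

text \<open>\<open>x - s (F x)\<close> projects onto the kernel of \<open>F\<close> and kills
  \<open>D\<close>; followed by coordinates on the kernel it gives \<open>r\<close>.\<close>

lemma abelian_complement:
  fixes F :: "'a::euclidean_space \<Rightarrow> 'b::euclidean_space"
  assumes lin: "linear F" and surj: "range F = UNIV"
    and D: "subspace D" "\<And>x. x \<in> D \<Longrightarrow> F x = 0 \<Longrightarrow> x = 0"
  obtains r :: "'a \<Rightarrow> nat \<Rightarrow> real" where "linear r" "\<And>x. x \<in> D \<Longrightarrow> r x = 0"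
    "bij_betw (\<lambda>x. (F x, r x)) UNIV (UNIV \<times> lie_carrier (abelian_alg (DIM('a) - DIM('b))))"
proof -
  let ?K = "{x. F x = 0}"
  obtain s where s: "linear s" "\<And>w. F (s w) = w" "\<And>x. x \<in> D \<Longrightarrow> s (F x) = x"
    using section_fixing_subspace[OF assms] by metis
  obtain \<phi> :: "'a \<Rightarrow> nat \<Rightarrow> real" where \<phi>: "linear \<phi>" "bij_betw \<phi> ?K {y. \<forall>i\<ge>dim ?K. y i = 0}"
    by (rule subspace_coordinates[OF linear_subspace_kernel[OF lin]])
  have bij: "bij_betw \<phi> ?K (lie_carrier (abelian_alg (DIM('a) - DIM('b))))"
    using \<phi>(2) by (simp add: dim_kernel[OF lin surj] abelian_alg_def)
  define \<pi> where "\<pi> x = x - s (F x)" for x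
  have lin\<pi>: "linear \<pi>"
    by (rule linearI) (simp_all add: \<pi>_def linear_add[OF lin] linear_add[OF s(1)]
        linear_scale[OF lin] linear_scale[OF s(1)] algebra_simps)
  have \<pi>K: "\<pi> x \<in> ?K" for x by (simp add: \<pi>_def linear_diff[OF lin] s(2))
  show thesis
  proof
    show "linear (\<phi> \<circ> \<pi>)" by (rule linear_compose[OF lin\<pi> \<phi>(1)])
    show "(\<phi> \<circ> \<pi>) x = 0" if "x \<in> D" for x
      using that s(3) by (simp add: \<pi>_def linear_0[OF \<phi>(1)])
    show "bij_betw (\<lambda>x. (F x, (\<phi> \<circ> \<pi>) x)) UNIV
        (UNIV \<times> lie_carrier (abelian_alg (DIM('a) - DIM('b))))"
      unfolding bij_betw_def
    proof
      show "inj (\<lambda>x. (F x, (\<phi> \<circ> \<pi>) x))"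
      proof (rule injI)
        fix x y assume eq: "(F x, (\<phi> \<circ> \<pi>) x) = (F y, (\<phi> \<circ> \<pi>) y)"
        then have "\<pi> x = \<pi> y"
          using bij \<pi>K by (auto simp: bij_betw_def inj_on_def)
        then show "x = y" using eq by (simp add: \<pi>_def)
      qed
      show "range (\<lambda>x. (F x, (\<phi> \<circ> \<pi>) x)) = UNIV \<times> lie_carrier (abelian_alg (DIM('a) - DIM('b)))"
      proof
        show "range (\<lambda>x. (F x, (\<phi> \<circ> \<pi>) x)) \<subseteq> UNIV \<times> lie_carrier (abelian_alg (DIM('a) - DIM('b)))"
          using bij \<pi>K by (auto simp: bij_betw_def)
        show "UNIV \<times> lie_carrier (abelian_alg (DIM('a) - DIM('b))) \<subseteq> range (\<lambda>x. (F x, (\<phi> \<circ> \<pi>) x))"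
        proof clarify
          fix w :: 'b and y :: "nat \<Rightarrow> real" assume "y \<in> lie_carrier (abelian_alg (DIM('a) - DIM('b)))"
          then have "y \<in> \<phi> ` ?K" using bij by (simp add: bij_betw_imp_surj_on)
          then obtain k where k: "F k = 0" "\<phi> k = y" by blast
          then have "F (s w + k) = w" "\<pi> (s w + k) = k"
            by (simp_all add: \<pi>_def linear_add[OF lin] s(2))
          then show "(w, y) \<in> range (\<lambda>x. (F x, (\<phi> \<circ> \<pi>) x))"
            using k(2) by (intro range_eqI[of _ _ "s w + k"]) simp
        qed
      qed
    qed
  qed
qed

text \<open>The kernel of \<open>F\<close> is an ideal meeting the derived algebra trivially, hence
  central. Coordinates \<open>r\<close> vanishing on the derived algebra send every bracket to 0, as
  the Abelian summand requires.\<close>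

lemma lie_isomorphic_sum_abelian:
  fixes F :: "'a::euclidean_space \<Rightarrow> 'b::euclidean_space"
  assumes "linear F" "range F = UNIV" "\<And>x. x \<in> derived_algebra br \<Longrightarrow> F x = 0 \<Longrightarrow> x = 0"
    and "\<And>x y. F (br x y) = b (F x) (F y)" "DIM('a) - DIM('b) = k"
  shows "whole_alg br \<cong>\<^sub>L whole_alg b \<oplus>\<^sub>L abelian_alg k"
proof -
  have "subspace (derived_algebra br)" by (simp add: derived_algebra_def)
  then obtain r :: "'a \<Rightarrow> nat \<Rightarrow> real" where r: "linear r" "\<And>x. x \<in> derived_algebra br \<Longrightarrow> r x = 0"
    "bij_betw (\<lambda>x. (F x, r x)) UNIV (UNIV \<times> lie_carrier (abelian_alg k))"
    using abelian_complement[OF assms(1,2) _ assms(3)] assms(5) by metis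
  have "br x y \<in> derived_algebra br" for x y
    unfolding derived_algebra_def by (rule span_base) blast
  moreover have "linear (\<lambda>x. (F x, r x))"
    by (rule linearI) (simp_all add: linear_add[OF assms(1)] linear_add[OF r(1)]
        linear_scale[OF assms(1)] linear_scale[OF r(1)])
  ultimately show ?thesis
    using r(2,3) unfolding lie_isomorphic_def
    by (intro exI[of _ "\<lambda>x. (F x, r x)"])
      (simp add: whole_alg_def lie_sum_def abelian_alg_def assms(4) zero_fun_def)
qed

lemma lie_isomorphic_assoc:
  assumes "A \<cong>\<^sub>L whole_alg b \<oplus>\<^sub>L C"
    and b: "\<And>x y x' y'. b (x, y) (x', y') = (b1 x x', b2 y y')"
  shows "A \<cong>\<^sub>L whole_alg b1 \<oplus>\<^sub>L whole_alg b2 \<oplus>\<^sub>L C"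
proof -
  obtain f where f: "linear f"
    and bij: "bij_betw f (lie_carrier A) (lie_carrier (whole_alg b \<oplus>\<^sub>L C))"
    and hom: "\<forall>x\<in>lie_carrier A. \<forall>y\<in>lie_carrier A.
      f (lie_bracket A x y) = lie_bracket (whole_alg b \<oplus>\<^sub>L C) (f x) (f y)"
    using assms(1) unfolding lie_isomorphic_def by blast
  have bij: "bij_betw f (lie_carrier A) (UNIV \<times> lie_carrier C)"
    using bij by (simp add: lie_sum_def whole_alg_def)
  have b': "b p q = (b1 (fst p) (fst q), b2 (snd p) (snd q))" for p q
    using b[of "fst p" "snd p" "fst q" "snd q"] by simp
  let ?g = "\<lambda>((x, y), z). (x, y, z)"
  have "linear ?g" by (rule linearI) auto
  then have lin: "linear (?g \<circ> f)" using f linear_compose by blast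
  have "bij_betw ?g (UNIV \<times> lie_carrier C) (UNIV \<times> UNIV \<times> lie_carrier C)"
    by (rule bij_betw_byWitness[where f' = "\<lambda>(x, y, z). ((x, y), z)"]) auto
  then have "bij_betw (?g \<circ> f) (lie_carrier A) (UNIV \<times> UNIV \<times> lie_carrier C)"
    using bij bij_betw_trans by blast
  with lin show ?thesis
    unfolding lie_isomorphic_def using hom
    by (intro exI[of _ "?g \<circ> f"]) (simp add: lie_sum_def whole_alg_def b' case_prod_beta)
qed

subsection \<open>The cases\<close>

context almost_hermitian_lie_algebra
begin

section \<open>The space \<open>U\<close>, its dual and the frame adapted to it\<close>

abbreviation "U \<equiv> U_space br J"

lemma one_form_J_J: "linear \<gamma> \<Longrightarrow> \<gamma> (J (J x)) = - \<gamma> x"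
  for \<gamma> :: "'a \<Rightarrow> real"
  by (simp add: J_J linear_neg)

lemma subspace_J_derived: "subspace (J ` \<gg>')"
  by (rule linear_subspace_image[OF linear_J subspace_derived])

lemma U_iff: "y \<in> U \<longleftrightarrow> (\<forall>a\<in>\<gg>'. a \<bullet> y = 0 \<and> J a \<bullet> y = 0)"
proof
  assume y: "y \<in> U"
  have "a + J b \<in> {x + y | x y. x \<in> \<gg>' \<and> y \<in> J ` \<gg>'}" if "a \<in> \<gg>'" "b \<in> \<gg>'" for a b
    using that by blast
  then have *: "(a + J b) \<bullet> y = 0" if "a \<in> \<gg>'" "b \<in> \<gg>'" for a b
    using y that by (auto simp: U_space_def orthogonal_comp_def orthogonal_def)
  show "\<forall>a\<in>\<gg>'. a \<bullet> y = 0 \<and> J a \<bullet> y = 0"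
    using *[of _ 0] *[of 0] subspace_0[OF subspace_derived] by (simp add: J_lin)
next
  assume "\<forall>a\<in>\<gg>'. a \<bullet> y = 0 \<and> J a \<bullet> y = 0"
  then show "y \<in> U"
    by (auto simp: U_space_def orthogonal_comp_def orthogonal_def inner_add_left)
qed

lemma subspace_U: "subspace U"
  unfolding U_space_def by (rule subspace_orthogonal_comp)

lemma U_J: "y \<in> U \<Longrightarrow> J y \<in> U"
  unfolding U_iff inner_J using inner_J_left[of _ y] by auto

text \<open>A subspace is its own double complement; extension by zero thus means vanishing on the
  derived algebra and on its image under \<open>J\<close>.\<close>

lemma orthogonal_comp_U: "orthogonal_comp U = {x + y | x y. x \<in> \<gg>' \<and> y \<in> J ` \<gg>'}"
  unfolding U_space_def
  by (rule orthogonal_comp_self) (rule subspace_sums[OF subspace_derived subspace_J_derived])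

lemma dual_U_iff:
  "\<gamma> \<in> dual_space U \<longleftrightarrow> linear \<gamma> \<and> (\<forall>x\<in>\<gg>'. \<gamma> x = 0 \<and> \<gamma> (J x) = 0)"
proof
  assume \<gamma>: "\<gamma> \<in> dual_space U"
  have "x \<in> orthogonal_comp U" "J x \<in> orthogonal_comp U" if "x \<in> \<gg>'" for x
    using that subspace_0[OF subspace_derived] subspace_0[OF subspace_J_derived]
    unfolding orthogonal_comp_U by force+
  then show "linear \<gamma> \<and> (\<forall>x\<in>\<gg>'. \<gamma> x = 0 \<and> \<gamma> (J x) = 0)"
    using \<gamma> by (simp add: dual_space_def)
next
  assume "linear \<gamma> \<and> (\<forall>x\<in>\<gg>'. \<gamma> x = 0 \<and> \<gamma> (J x) = 0)"
  then show "\<gamma> \<in> dual_space U"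
    unfolding dual_space_def orthogonal_comp_U by (auto simp: linear_add)
qed

lemma span_frame:
  assumes "span S = \<gg>'"
  shows "span (S \<union> J ` S \<union> U) = UNIV"
proof -
  have "x \<in> span (S \<union> J ` S \<union> U)" for x
  proof -
    obtain y z where y: "y \<in> span U" and z: "\<And>w. w \<in> span U \<Longrightarrow> orthogonal z w" and x: "x = y + z"
      using orthogonal_subspace_decomp_exists[of U x] by metis
    have "z \<in> orthogonal_comp U"
      using z by (simp add: orthogonal_comp_def orthogonal_commute span_base)
    then obtain a b where z': "z = a + J b" "a \<in> span S" "b \<in> span S"
      unfolding orthogonal_comp_U using assms by auto
    have "J b \<in> span (J ` S)" using z'(3) linear_span_image[OF linear_J, of S] by blast
    then have "J b \<in> span (S \<union> J ` S \<union> U)" "a \<in> span (S \<union> J ` S \<union> U)" "y \<in> span (S \<union> J ` S \<union> U)"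
      using z'(2) y span_mono[of _ "S \<union> J ` S \<union> U"] by blast+
    then show ?thesis unfolding x z'(1) by (intro span_add)
  qed
  then show ?thesis by blast
qed

text \<open>A bilinear alternating map is determined by its values on a spanning frame.
  \<open>X1 = X2\<close> is allowed, which covers a one-dimensional derived algebra.\<close>

lemma bracket_eqI:
  assumes f: "bilinear f" "\<And>x. f x x = 0" and S: "span {X1, X2} = \<gg>'"
    and "br (J X1) X1 = f (J X1) X1" "br (J X2) X2 = f (J X2) X2" "br X1 X2 = f X1 X2"
    "br (J X1) (J X2) = f (J X1) (J X2)" "br (J X1) X2 = f (J X1) X2" "br (J X2) X1 = f (J X2) X1"
    and U: "\<And>y. y \<in> U \<Longrightarrow> br y X1 = f y X1 \<and> br y (J X1) = f y (J X1)"
    "\<And>y. y \<in> U \<Longrightarrow> br y X2 = f y X2 \<and> br y (J X2) = f y (J X2)"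
    "\<And>y z. y \<in> U \<Longrightarrow> z \<in> U \<Longrightarrow> br y z = f y z"
  shows "br x y = f x y"
proof -
  let ?S = "{X1, X2} \<union> J ` {X1, X2} \<union> U"
  have flip: "br v u = f v u" if "br u v = f u v" for u v
    using that br_antisym[of v u] alternating_antisym[OF f, of v u] by simp
  note eqs = assms(4-9) assms(4-9)[THEN flip] br_self f(2) U U(1,2)[THEN conjunct1, THEN flip]
    U(1,2)[THEN conjunct2, THEN flip]
  have "br u v = f u v" if uv: "u \<in> ?S" "v \<in> ?S" for u v
  proof -
    consider "u = X1" | "u = X2" | "u = J X1" | "u = J X2" | "u \<in> U" using uv(1) by blast
    then show ?thesis
      by cases (use uv(2) in \<open>auto simp: eqs\<close>)
  qed
  then show ?thesis
    using bilinear_eq[OF bilinear_br f(1), of UNIV ?S UNIV ?S x y] span_frame[OF S] by simp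
qed

section \<open>From the listed brackets to the split form\<close>

lemma bilinear_split:
  assumes "linear \<gamma>1" "linear \<gamma>2"
  shows "bilinear (\<lambda>x y. (c1 * wedge \<gamma>1 (\<gamma>1 \<circ> J) x y) *\<^sub>R X1 + (c2 * wedge \<gamma>2 (\<gamma>2 \<circ> J) x y) *\<^sub>R X2)"
  using bilinear_wedge_J[OF assms(1), of c1 X1] bilinear_wedge_J[OF assms(2), of c2 X2]
  unfolding bilinear_def by (intro conjI allI linear_compose_add) simp_all

lemma linear_component: "linear (\<lambda>x. X \<bullet> br x Y)"
  by (rule linearI) (simp_all add: br_add br_scale inner_add_right)

text \<open>The global one-form is the \<open>X\<close>-component of the bracket with
  \<open>X\<close>: it extends \<open>\<mu>\<close> from \<open>U\<close>, with value 0 at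
  \<open>X\<close> and \<open>l\<close> at \<open>J X\<close>. The wedge at \<open>J X\<close>,
  \<open>X\<close> is then l^2, and the factor \<open>1 / l\<close> restores
  \<open>l\<close>.\<close>

lemma split_if_case_a_i:
  assumes "case_a_i br J X" "span {X} = \<gg>'" "norm X = 1"
  obtains l \<gamma> where "l \<noteq> 0" "\<gamma> X = 0" "\<gamma> (J X) = l" "split_bracket (1 / l) \<gamma> X 0 (\<lambda>_. 0) 0"
proof -
  obtain l \<mu> where l: "l \<noteq> 0" and X: "br (J X) X = l *\<^sub>R X"
    and YX: "\<And>Y. Y \<in> U \<Longrightarrow> br Y X = \<mu> Y *\<^sub>R X \<and> br Y (J X) = - \<mu> (J Y) *\<^sub>R X"
    and YZ: "\<And>Y Z. Y \<in> U \<Longrightarrow> Z \<in> U \<Longrightarrow> br Y Z = ((1 / l) * wedge \<mu> (\<mu> \<circ> J) Y Z) *\<^sub>R X"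
    using assms(1) unfolding case_a_i_def by blast
  have XX: "X \<bullet> X = 1" using assms(3) by (simp add: norm_eq_1)
  define \<gamma> where "\<gamma> x = X \<bullet> br x X" for x
  have lin: "linear \<gamma>" unfolding \<gamma>_def by (rule linear_component)
  have \<gamma>X: "\<gamma> X = 0" "\<gamma> (J X) = l" using X XX by (simp_all add: \<gamma>_def br_self)
  have \<gamma>U: "\<gamma> y = \<mu> y" if "y \<in> U" for y using YX[OF that] XX by (simp add: \<gamma>_def)
  note JJ = one_form_J_J[OF lin]
  have "br x y = (1 / l * wedge \<gamma> (\<gamma> \<circ> J) x y) *\<^sub>R X + (0 * wedge (\<lambda>_. 0) ((\<lambda>_. 0) \<circ> J) x y) *\<^sub>R 0" for x y
    by (rule bracket_eqI[OF bilinear_split[OF lin linear_zero], where ?X1.0 = X and ?X2.0 = X])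
      (simp_all add: assms(2) \<gamma>X l JJ X YX YZ \<gamma>U U_J wedge_def br_self)
  then have "split_bracket (1 / l) \<gamma> X 0 (\<lambda>_. 0) 0"
    using lin by (simp add: split_bracket_def linear_zero)
  with l \<gamma>X show thesis by (rule that)
qed

text \<open>Unlike the affine case, \<open>\<alpha>\<close> extended by zero already is the global
  one-form.\<close>

lemma split_if_case_a_ii:
  assumes "case_a_ii br J X" "span {X} = \<gg>'" "norm X = 1"
  obtains \<alpha> where "\<alpha> \<noteq> (\<lambda>_. 0)" "\<alpha> \<in> dual_space U" "split_bracket 1 \<alpha> X 0 (\<lambda>_. 0) 0"
proof -
  obtain \<alpha> where \<alpha>: "\<alpha> \<in> dual_space U" "\<alpha> \<noteq> (\<lambda>_. 0)" and X: "br (J X) X = 0"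
    and YX: "\<And>Y. Y \<in> U \<Longrightarrow> br Y X = 0 \<and> br Y (J X) = 0"
    and YZ: "\<And>Y Z. Y \<in> U \<Longrightarrow> Z \<in> U \<Longrightarrow> br Y Z = wedge \<alpha> (\<alpha> \<circ> J) Y Z *\<^sub>R X"
    using assms(1) unfolding case_a_ii_def by blast
  have "X \<in> \<gg>'" using assms(2) by (metis singletonI span_base)
  then have lin: "linear \<alpha>" and \<alpha>X: "\<alpha> X = 0" "\<alpha> (J X) = 0"
    using \<alpha>(1) by (auto simp: dual_U_iff)
  note JJ = one_form_J_J[OF lin]
  have "br x y = (1 * wedge \<alpha> (\<alpha> \<circ> J) x y) *\<^sub>R X + (0 * wedge (\<lambda>_. 0) ((\<lambda>_. 0) \<circ> J) x y) *\<^sub>R 0" for x y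
    by (rule bracket_eqI[OF bilinear_split[OF lin linear_zero], where ?X1.0 = X and ?X2.0 = X])
      (simp_all add: assms(2) \<alpha>X JJ X YX YZ wedge_def br_self)
  then have "split_bracket 1 \<alpha> X 0 (\<lambda>_. 0) 0"
    using lin by (simp add: split_bracket_def linear_zero)
  with \<alpha>(2,1) show thesis by (rule that)
qed

context
  fixes X1 X2 :: 'a
  assumes onb: "orthonormal_basis2 \<gg>' X1 X2"
begin

text \<open>The vanishing mixed brackets make each reconstructed one-form zero on the other
  direction and its image under \<open>J\<close>, so the two summands do not interact.\<close>

lemma split_if_case_b_i:
  assumes "case_b_i br J X1 X2"
  obtains l1 l2 \<gamma>1 \<gamma>2 where "l1 \<noteq> 0" "l2 \<noteq> 0"
    "\<gamma>1 X1 = 0" "\<gamma>1 (J X1) = l1" "\<gamma>1 X2 = 0" "\<gamma>1 (J X2) = 0"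
    "\<gamma>2 X2 = 0" "\<gamma>2 (J X2) = l2" "\<gamma>2 X1 = 0" "\<gamma>2 (J X1) = 0"
    "split_bracket (1 / l1) \<gamma>1 X1 (1 / l2) \<gamma>2 X2"
proof -
  obtain l1 l2 \<mu>1 \<mu>2 where l: "l1 \<noteq> 0" "l2 \<noteq> 0"
    and X: "br (J X1) X1 = l1 *\<^sub>R X1" "br (J X2) X2 = l2 *\<^sub>R X2"
      "br X1 X2 = 0" "br (J X1) (J X2) = 0" "br (J X1) X2 = 0" "br (J X2) X1 = 0"
    and YX: "\<And>Y. Y \<in> U \<Longrightarrow> br Y X1 = \<mu>1 Y *\<^sub>R X1 \<and> br Y (J X1) = - \<mu>1 (J Y) *\<^sub>R X1 \<and>
        br Y X2 = \<mu>2 Y *\<^sub>R X2 \<and> br Y (J X2) = - \<mu>2 (J Y) *\<^sub>R X2"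
    and YZ: "\<And>Y Z. Y \<in> U \<Longrightarrow> Z \<in> U \<Longrightarrow> br Y Z = ((1 / l1) * wedge \<mu>1 (\<mu>1 \<circ> J) Y Z) *\<^sub>R X1
               + ((1 / l2) * wedge \<mu>2 (\<mu>2 \<circ> J) Y Z) *\<^sub>R X2"
    using assms(1) unfolding case_b_i_def by blast
  note i = onb_inner[OF onb]
  define \<gamma>1 where "\<gamma>1 x = X1 \<bullet> br x X1" for x
  define \<gamma>2 where "\<gamma>2 x = X2 \<bullet> br x X2" for x
  have lin: "linear \<gamma>1" "linear \<gamma>2" unfolding \<gamma>1_def \<gamma>2_def by (rule linear_component)+
  have "br X2 X1 = 0" using br_antisym[of X2 X1] X by simp
  then have \<gamma>X: "\<gamma>1 X1 = 0" "\<gamma>1 (J X1) = l1" "\<gamma>1 X2 = 0" "\<gamma>1 (J X2) = 0"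
    "\<gamma>2 X2 = 0" "\<gamma>2 (J X2) = l2" "\<gamma>2 X1 = 0" "\<gamma>2 (J X1) = 0"
    using X i by (simp_all add: \<gamma>1_def \<gamma>2_def br_self)
  have \<gamma>U: "\<gamma>1 y = \<mu>1 y" "\<gamma>2 y = \<mu>2 y" if "y \<in> U" for y
    using YX[OF that] i by (simp_all add: \<gamma>1_def \<gamma>2_def)
  note JJ = one_form_J_J[OF lin(1)] one_form_J_J[OF lin(2)]
  have span: "span {X1, X2} = \<gg>'" using onb by (simp add: orthonormal_basis2_def)
  have "br x y = (1 / l1 * wedge \<gamma>1 (\<gamma>1 \<circ> J) x y) *\<^sub>R X1 + (1 / l2 * wedge \<gamma>2 (\<gamma>2 \<circ> J) x y) *\<^sub>R X2" for x y
    by (rule bracket_eqI[OF bilinear_split[OF lin], where ?X1.0 = X1 and ?X2.0 = X2])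
      (simp_all add: span \<gamma>X l JJ X YX YZ \<gamma>U U_J wedge_def br_self)
  then have "split_bracket (1 / l1) \<gamma>1 X1 (1 / l2) \<gamma>2 X2"
    using lin by (simp add: split_bracket_def)
  with l \<gamma>X show thesis by (rule that)
qed

lemma split_if_case_b_ii:
  assumes "case_b_ii br J X1 X2"
  obtains l \<gamma> \<alpha> where "l \<noteq> 0" "\<gamma> X1 = 0" "\<gamma> (J X1) = l" "\<gamma> X2 = 0" "\<gamma> (J X2) = 0"
    "\<alpha> \<noteq> (\<lambda>_. 0)" "\<alpha> \<in> dual_space U" "split_bracket (1 / l) \<gamma> X1 1 \<alpha> X2"
proof -
  obtain l \<mu> \<alpha> where l: "l \<noteq> 0" and \<alpha>: "\<alpha> \<in> dual_space U" "\<alpha> \<noteq> (\<lambda>_. 0)"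
    and X: "br (J X1) X1 = l *\<^sub>R X1" "br (J X2) X2 = 0"
      "br X1 X2 = 0" "br (J X1) (J X2) = 0" "br (J X1) X2 = 0" "br (J X2) X1 = 0"
    and YX: "\<And>Y. Y \<in> U \<Longrightarrow> br Y X1 = \<mu> Y *\<^sub>R X1 \<and> br Y (J X1) = - \<mu> (J Y) *\<^sub>R X1 \<and>
        br Y X2 = 0 \<and> br Y (J X2) = 0"
    and YZ: "\<And>Y Z. Y \<in> U \<Longrightarrow> Z \<in> U \<Longrightarrow> br Y Z = ((1 / l) * wedge \<mu> (\<mu> \<circ> J) Y Z) *\<^sub>R X1
               + wedge \<alpha> (\<alpha> \<circ> J) Y Z *\<^sub>R X2"
    using assms(1) unfolding case_b_ii_def by blast
  note i = onb_inner[OF onb]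
  define \<gamma> where "\<gamma> x = X1 \<bullet> br x X1" for x
  have lin: "linear \<gamma>" "linear \<alpha>"
    using \<alpha>(1) linear_component unfolding \<gamma>_def dual_U_iff by blast+
  have "br X2 X1 = 0" using br_antisym[of X2 X1] X by simp
  then have \<gamma>X: "\<gamma> X1 = 0" "\<gamma> (J X1) = l" "\<gamma> X2 = 0" "\<gamma> (J X2) = 0"
    using X i by (simp_all add: \<gamma>_def br_self)
  have \<alpha>X: "\<alpha> X1 = 0" "\<alpha> (J X1) = 0" "\<alpha> X2 = 0" "\<alpha> (J X2) = 0"
    using \<alpha>(1) onb_mem[OF onb] by (auto simp: dual_U_iff)
  have \<gamma>U: "\<gamma> y = \<mu> y" if "y \<in> U" for y
    using YX[OF that] i by (simp add: \<gamma>_def)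
  note JJ = one_form_J_J[OF lin(1)] one_form_J_J[OF lin(2)]
  have span: "span {X1, X2} = \<gg>'" using onb by (simp add: orthonormal_basis2_def)
  have "br x y = (1 / l * wedge \<gamma> (\<gamma> \<circ> J) x y) *\<^sub>R X1 + (1 * wedge \<alpha> (\<alpha> \<circ> J) x y) *\<^sub>R X2" for x y
    by (rule bracket_eqI[OF bilinear_split[OF lin], where ?X1.0 = X1 and ?X2.0 = X2])
      (simp_all add: span \<gamma>X \<alpha>X l JJ X YX YZ \<gamma>U U_J wedge_def br_self)
  then have "split_bracket (1 / l) \<gamma> X1 1 \<alpha> X2"
    using lin by (simp add: split_bracket_def)
  with l \<gamma>X \<alpha>(2,1) show thesis by (rule that)
qed

lemma split_if_case_b_iii:
  assumes "case_b_iii br J X1 X2"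
  obtains \<alpha> \<beta> where "\<alpha> \<in> dual_space U" "\<beta> \<in> dual_space U" "complex_independent J \<alpha> \<beta>"
    "split_bracket 1 \<alpha> X1 1 \<beta> X2"
proof -
  obtain \<alpha> \<beta> where d: "\<alpha> \<in> dual_space U" "\<beta> \<in> dual_space U" "complex_independent J \<alpha> \<beta>"
    and X: "br (J X1) X1 = 0" "br (J X2) X2 = 0"
      "br X1 X2 = 0" "br (J X1) (J X2) = 0" "br (J X1) X2 = 0" "br (J X2) X1 = 0"
    and YX: "\<And>Y. Y \<in> U \<Longrightarrow> br Y X1 = 0 \<and> br Y (J X1) = 0 \<and> br Y X2 = 0 \<and> br Y (J X2) = 0"
    and YZ: "\<And>Y Z. Y \<in> U \<Longrightarrow> Z \<in> U \<Longrightarrow>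
      br Y Z = wedge \<alpha> (\<alpha> \<circ> J) Y Z *\<^sub>R X1 + wedge \<beta> (\<beta> \<circ> J) Y Z *\<^sub>R X2"
    using assms(1) unfolding case_b_iii_def by blast
  have lin: "linear \<alpha>" "linear \<beta>" using d by (auto simp: dual_U_iff)
  have dX: "\<alpha> X1 = 0" "\<alpha> (J X1) = 0" "\<alpha> X2 = 0" "\<alpha> (J X2) = 0"
    "\<beta> X1 = 0" "\<beta> (J X1) = 0" "\<beta> X2 = 0" "\<beta> (J X2) = 0"
    using d(1,2) onb_mem[OF onb] by (auto simp: dual_U_iff)
  note JJ = one_form_J_J[OF lin(1)] one_form_J_J[OF lin(2)]
  have span: "span {X1, X2} = \<gg>'" using onb by (simp add: orthonormal_basis2_def)
  have "br x y = (1 * wedge \<alpha> (\<alpha> \<circ> J) x y) *\<^sub>R X1 + (1 * wedge \<beta> (\<beta> \<circ> J) x y) *\<^sub>R X2" for x y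
    by (rule bracket_eqI[OF bilinear_split[OF lin], where ?X1.0 = X1 and ?X2.0 = X2])
      (simp_all add: span dX JJ X YX YZ wedge_def br_self)
  then have "split_bracket 1 \<alpha> X1 1 \<beta> X2"
    using lin by (simp add: split_bracket_def)
  with d show thesis by (rule that)
qed

end

text \<open>Restricting \<open>\<omega> = \<alpha> \<and> J\<^sup>*\<alpha>\<close> to \<open>U\<close> in terms of \<open>\<mu> = \<omega>(\<cdot>, X)\<close>: on \<open>U\<close> the forms \<open>\<mu>\<close> and \<open>J\<^sup>*\<mu>\<close>
  arise from \<open>\<alpha>\<close> and \<open>J\<^sup>*\<alpha>\<close> by a complex factor of squared modulus \<open>\<omega>(JX, X)\<close>.\<close>

lemma wedge_J_on_U:
  assumes lin: "linear \<alpha>" and l: "\<alpha> X \<noteq> 0 \<or> \<alpha> (J X) \<noteq> 0"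
  defines "l \<equiv> wedge \<alpha> (\<alpha> \<circ> J) (J X) X"
  obtains \<mu> where "l \<noteq> 0" "\<mu> \<in> dual_space U"
    "\<And>Y. Y \<in> U \<Longrightarrow> wedge \<alpha> (\<alpha> \<circ> J) Y X = \<mu> Y"
    "\<And>Y. Y \<in> U \<Longrightarrow> wedge \<alpha> (\<alpha> \<circ> J) Y (J X) = - \<mu> (J Y)"
    "\<And>Y Z. Y \<in> U \<Longrightarrow> Z \<in> U \<Longrightarrow> wedge \<alpha> (\<alpha> \<circ> J) Y Z = (1 / l) * wedge \<mu> (\<mu> \<circ> J) Y Z"
proof -
  have l': "l = (\<alpha> X)\<^sup>2 + (\<alpha> (J X))\<^sup>2"
    by (simp add: l_def wedge_def one_form_J_J[OF lin] power2_eq_square)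
  then have l0: "l \<noteq> 0" using l by (simp add: sum_power2_eq_zero_iff)
  have "linear (\<lambda>Y. wedge \<alpha> (\<alpha> \<circ> J) Y X)"
    by (rule linearI) (simp_all add: wedge_def linear_add[OF lin] linear_scale[OF lin] J_lin algebra_simps)
  then obtain \<mu> where \<mu>: "\<mu> \<in> dual_space U" "\<And>Y. Y \<in> U \<Longrightarrow> \<mu> Y = wedge \<alpha> (\<alpha> \<circ> J) Y X"
    using dual_space_restrict[OF subspace_U] by metis
  have \<mu>JY: "\<mu> (J Y) = \<alpha> (J Y) * \<alpha> (J X) + \<alpha> X * \<alpha> Y" if "Y \<in> U" for Y
    using \<mu>(2)[OF U_J[OF that]] by (simp add: wedge_def one_form_J_J[OF lin])
  have \<mu>Y: "\<mu> Y = \<alpha> Y * \<alpha> (J X) - \<alpha> X * \<alpha> (J Y)" if "Y \<in> U" for Y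
    using \<mu>(2)[OF that] by (simp add: wedge_def)
  show thesis
  proof (rule that[OF l0 \<mu>(1)])
    show "wedge \<alpha> (\<alpha> \<circ> J) Y X = \<mu> Y" if "Y \<in> U" for Y using \<mu>(2)[OF that] by simp
    show "wedge \<alpha> (\<alpha> \<circ> J) Y (J X) = - \<mu> (J Y)" if "Y \<in> U" for Y
      using \<mu>JY[OF that] by (simp add: wedge_def one_form_J_J[OF lin] algebra_simps)
    show "wedge \<alpha> (\<alpha> \<circ> J) Y Z = (1 / l) * wedge \<mu> (\<mu> \<circ> J) Y Z" if "Y \<in> U" "Z \<in> U" for Y Z
    proof -
      have "wedge \<mu> (\<mu> \<circ> J) Y Z = l * wedge \<alpha> (\<alpha> \<circ> J) Y Z"
        unfolding wedge_def comp_def \<mu>Y[OF that(1)] \<mu>Y[OF that(2)] \<mu>JY[OF that(1)] \<mu>JY[OF that(2)] l'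
        by algebra
      then show ?thesis using l0 by simp
    qed
  qed
qed

section \<open>Sorting the split bracket into the listed cases\<close>

lemma dual_U_I:
  assumes "orthonormal_basis2 \<gg>' X1 X2" and lin: "linear \<alpha>"
    and "\<alpha> X1 = 0" "\<alpha> (J X1) = 0" "\<alpha> X2 = 0" "\<alpha> (J X2) = 0"
  shows "\<alpha> \<in> dual_space U"
  unfolding dual_U_iff
proof (intro conjI ballI lin)
  fix x assume "x \<in> \<gg>'"
  note x = onb_expand[OF assms(1) this]
  show "\<alpha> x = 0" "\<alpha> (J x) = 0"
    by (subst x, simp add: J_lin linear_add[OF lin] linear_scale[OF lin] assms)+
qed

text \<open>\<open>J v\<close> is orthogonal to \<open>v\<close>, so a line meets its image under
  \<open>J\<close> only in 0.\<close>

lemma totally_real_dim1: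
  assumes "dim \<gg>' = 1"
  shows "totally_real J \<gg>'"
proof -
  have "x = 0" if xy: "x \<in> \<gg>'" "x = J y" "y \<in> \<gg>'" for x y
  proof -
    obtain B where B: "card B = 1" "span B = \<gg>'"
      using orthonormal_basis_subspace[OF subspace_derived] assms by metis
    then obtain b where "span {b} = \<gg>'" by (auto simp: card_1_singleton_iff)
    then have "x \<in> range (\<lambda>k. k *\<^sub>R b)" "y \<in> range (\<lambda>k. k *\<^sub>R b)"
      using xy(1,3) by (simp_all add: span_singleton)
    then obtain s t where st: "x = s *\<^sub>R b" "y = t *\<^sub>R b" by blast
    have "x \<bullet> x = s *\<^sub>R b \<bullet> J (t *\<^sub>R b)" using xy(2) st by metis
    then have "x \<bullet> x = 0" by (simp add: J_lin inner_self_J)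
    then show ?thesis by simp
  qed
  then show ?thesis
    using subspace_0[OF subspace_derived] subspace_0[OF subspace_J_derived]
    unfolding totally_real_def by blast
qed

lemma case_a_if_SKT:
  assumes "SKT br J" "dim \<gg>' = 1"
  shows "\<exists>X\<in>\<gg>'. norm X = 1 \<and> (case_a_i br J X \<or> case_a_ii br J X)"
proof -
  obtain X \<alpha> where X: "X \<in> \<gg>'" "norm X = 1" and lin: "linear \<alpha>"
    and br: "\<And>x y. br x y = wedge \<alpha> (\<alpha> \<circ> J) x y *\<^sub>R X"
    by (rule split_bracket_dim1[OF assms(1) totally_real_dim1[OF assms(2)] assms(2)]) blast
  have "case_a_i br J X \<or> case_a_ii br J X"
  proof (cases "\<alpha> X = 0 \<and> \<alpha> (J X) = 0")
    case False
    then have "\<alpha> X \<noteq> 0 \<or> \<alpha> (J X) \<noteq> 0" by blast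
    then obtain \<mu> where \<mu>: "wedge \<alpha> (\<alpha> \<circ> J) (J X) X \<noteq> 0" "\<mu> \<in> dual_space U"
      "\<And>Y. Y \<in> U \<Longrightarrow> wedge \<alpha> (\<alpha> \<circ> J) Y X = \<mu> Y"
      "\<And>Y. Y \<in> U \<Longrightarrow> wedge \<alpha> (\<alpha> \<circ> J) Y (J X) = - \<mu> (J Y)"
      "\<And>Y Z. Y \<in> U \<Longrightarrow> Z \<in> U \<Longrightarrow> wedge \<alpha> (\<alpha> \<circ> J) Y Z
        = (1 / wedge \<alpha> (\<alpha> \<circ> J) (J X) X) * wedge \<mu> (\<mu> \<circ> J) Y Z"
      using wedge_J_on_U[OF lin, of X] by metis
    then have "case_a_i br J X"
      unfolding case_a_i_def
      by (intro exI[of _ "wedge \<alpha> (\<alpha> \<circ> J) (J X) X"] exI[of _ \<mu>]) (simp add: br)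
    then show ?thesis ..
  next
    case True
    have "x \<in> span {X}" if "x \<in> \<gg>'" for x
    proof -
      have "\<gg>' \<subseteq> span {X}"
        unfolding derived_algebra_def by (intro span_minimal) (auto simp: br span_base span_scale)
      then show ?thesis using that by blast
    qed
    then have "\<alpha> \<in> dual_space U"
      using True lin by (force simp: dual_U_iff span_singleton J_lin linear_scale)
    moreover have "\<alpha> \<noteq> (\<lambda>_. 0)"
    proof
      assume "\<alpha> = (\<lambda>_. 0)"
      then have "br x y = 0" for x y by (simp add: br wedge_def)
      then show False using br_nonzero assms(2) by simp
    qed
    ultimately have "case_a_ii br J X"
      unfolding case_a_ii_def using True
      by (intro bexI[of _ \<alpha>]) (simp_all add: br wedge_def one_form_J_J[OF lin])
    then show ?thesis ..
  qed
  with X show ?thesis by blast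
qed

lemma case_b_if_SKT:
  assumes "SKT br J" "totally_real J \<gg>'" "dim \<gg>' = 2"
  shows "\<exists>X1 X2. orthonormal_basis2 \<gg>' X1 X2 \<and>
    (case_b_i br J X1 X2 \<or> case_b_ii br J X1 X2 \<or> case_b_iii br J X1 X2)"
proof -
  obtain X1 X2 \<alpha>1 \<alpha>2 where onb: "orthonormal_basis2 \<gg>' X1 X2" and split: "split_bracket 1 \<alpha>1 X1 1 \<alpha>2 X2"
    by (rule split_bracket_dim2[OF assms])
  note split' = split[unfolded split_bracket_swap[of 1 \<alpha>1]] and onb' = onb_swap[OF onb]
  note ind = split_bracket_independent[OF split assms(3)] split_bracket_independent[OF split' assms(3)]
  note cross = split_bracket_cross[OF split ind(1) onb] split_bracket_cross[OF split' ind(2) onb']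
  \<comment> \<open>Stated for arbitrary names, since either of the two directions may be the affine
    one.\<close>
  have case_ii: "case_b_ii br J X1 X2"
    if onb: "orthonormal_basis2 \<gg>' X1 X2" and split: "split_bracket 1 \<alpha>1 X1 1 \<alpha>2 X2"
      and ind: "complex_independent J \<alpha>2 \<alpha>1"
      and cross: "\<alpha>1 X2 = 0" "\<alpha>1 (J X2) = 0" "\<alpha>2 X1 = 0" "\<alpha>2 (J X1) = 0"
      and nz: "\<alpha>1 X1 \<noteq> 0 \<or> \<alpha>1 (J X1) \<noteq> 0" and z: "\<alpha>2 X2 = 0" "\<alpha>2 (J X2) = 0" for X1 X2 \<alpha>1 \<alpha>2
  proof -
    have lin: "linear \<alpha>1" "linear \<alpha>2"
      and br: "\<And>x y. br x y = wedge \<alpha>1 (\<alpha>1 \<circ> J) x y *\<^sub>R X1 + wedge \<alpha>2 (\<alpha>2 \<circ> J) x y *\<^sub>R X2"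
      using split by (auto simp: split_bracket_def)
    note w = wedge_def one_form_J_J[OF lin(1)] one_form_J_J[OF lin(2)] cross z
    obtain \<mu> where \<mu>: "wedge \<alpha>1 (\<alpha>1 \<circ> J) (J X1) X1 \<noteq> 0" "\<mu> \<in> dual_space U"
      "\<And>Y. Y \<in> U \<Longrightarrow> wedge \<alpha>1 (\<alpha>1 \<circ> J) Y X1 = \<mu> Y"
      "\<And>Y. Y \<in> U \<Longrightarrow> wedge \<alpha>1 (\<alpha>1 \<circ> J) Y (J X1) = - \<mu> (J Y)"
      "\<And>Y Z. Y \<in> U \<Longrightarrow> Z \<in> U \<Longrightarrow> wedge \<alpha>1 (\<alpha>1 \<circ> J) Y Z
        = (1 / wedge \<alpha>1 (\<alpha>1 \<circ> J) (J X1) X1) * wedge \<mu> (\<mu> \<circ> J) Y Z"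
      using wedge_J_on_U[OF lin(1) nz] by metis
    have \<alpha>2: "\<alpha>2 \<in> dual_space U" by (rule dual_U_I[OF onb lin(2)]) (fact cross z)+
    have nz2: "\<alpha>2 \<noteq> (\<lambda>_. 0)"
    proof
      assume "\<alpha>2 = (\<lambda>_. 0)"
      then have "cscale J 1 \<alpha>2 Y + cscale J 0 \<alpha>1 Y = 0" for Y by (simp add: cscale_def)
      then show False using ind unfolding complex_independent_def by (metis zero_neq_one)
    qed
    show ?thesis
      unfolding case_b_ii_def
      by (rule exI[of _ "wedge \<alpha>1 (\<alpha>1 \<circ> J) (J X1) X1"], rule exI[of _ \<mu>], rule exI[of _ \<alpha>2])
        (use \<mu> \<alpha>2 nz2 in \<open>simp add: br\<close>, simp add: w)
  qed
  have lin: "linear \<alpha>1" "linear \<alpha>2"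
    and br: "\<And>x y. br x y = wedge \<alpha>1 (\<alpha>1 \<circ> J) x y *\<^sub>R X1 + wedge \<alpha>2 (\<alpha>2 \<circ> J) x y *\<^sub>R X2"
    using split by (auto simp: split_bracket_def)
  note w = wedge_def one_form_J_J[OF lin(1)] one_form_J_J[OF lin(2)] cross
  consider (i) "\<alpha>1 X1 \<noteq> 0 \<or> \<alpha>1 (J X1) \<noteq> 0" "\<alpha>2 X2 \<noteq> 0 \<or> \<alpha>2 (J X2) \<noteq> 0"
    | (ii) "\<alpha>1 X1 \<noteq> 0 \<or> \<alpha>1 (J X1) \<noteq> 0" "\<alpha>2 X2 = 0" "\<alpha>2 (J X2) = 0"
    | (ii') "\<alpha>2 X2 \<noteq> 0 \<or> \<alpha>2 (J X2) \<noteq> 0" "\<alpha>1 X1 = 0" "\<alpha>1 (J X1) = 0"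
    | (iii) "\<alpha>1 X1 = 0" "\<alpha>1 (J X1) = 0" "\<alpha>2 X2 = 0" "\<alpha>2 (J X2) = 0"
    by blast
  then show ?thesis
  proof cases
    case i
    obtain \<mu>1 where m1: "wedge \<alpha>1 (\<alpha>1 \<circ> J) (J X1) X1 \<noteq> 0" "\<mu>1 \<in> dual_space U"
      "\<And>Y. Y \<in> U \<Longrightarrow> wedge \<alpha>1 (\<alpha>1 \<circ> J) Y X1 = \<mu>1 Y"
      "\<And>Y. Y \<in> U \<Longrightarrow> wedge \<alpha>1 (\<alpha>1 \<circ> J) Y (J X1) = - \<mu>1 (J Y)"
      "\<And>Y Z. Y \<in> U \<Longrightarrow> Z \<in> U \<Longrightarrow> wedge \<alpha>1 (\<alpha>1 \<circ> J) Y Z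
        = (1 / wedge \<alpha>1 (\<alpha>1 \<circ> J) (J X1) X1) * wedge \<mu>1 (\<mu>1 \<circ> J) Y Z"
      using wedge_J_on_U[OF lin(1) i(1)] by metis
    obtain \<mu>2 where m2: "wedge \<alpha>2 (\<alpha>2 \<circ> J) (J X2) X2 \<noteq> 0" "\<mu>2 \<in> dual_space U"
      "\<And>Y. Y \<in> U \<Longrightarrow> wedge \<alpha>2 (\<alpha>2 \<circ> J) Y X2 = \<mu>2 Y"
      "\<And>Y. Y \<in> U \<Longrightarrow> wedge \<alpha>2 (\<alpha>2 \<circ> J) Y (J X2) = - \<mu>2 (J Y)"
      "\<And>Y Z. Y \<in> U \<Longrightarrow> Z \<in> U \<Longrightarrow> wedge \<alpha>2 (\<alpha>2 \<circ> J) Y Z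
        = (1 / wedge \<alpha>2 (\<alpha>2 \<circ> J) (J X2) X2) * wedge \<mu>2 (\<mu>2 \<circ> J) Y Z"
      using wedge_J_on_U[OF lin(2) i(2)] by metis
    \<comment> \<open>By the cross relations each form ignores the other direction entirely, so all
      mixed brackets vanish.\<close>
    have zero: "wedge \<alpha>1 (\<alpha>1 \<circ> J) x X2 = 0" "wedge \<alpha>1 (\<alpha>1 \<circ> J) x (J X2) = 0"
      "wedge \<alpha>1 (\<alpha>1 \<circ> J) X2 x = 0" "wedge \<alpha>1 (\<alpha>1 \<circ> J) (J X2) x = 0"
      "wedge \<alpha>2 (\<alpha>2 \<circ> J) x X1 = 0" "wedge \<alpha>2 (\<alpha>2 \<circ> J) x (J X1) = 0"
      "wedge \<alpha>2 (\<alpha>2 \<circ> J) X1 x = 0" "wedge \<alpha>2 (\<alpha>2 \<circ> J) (J X1) x = 0" for x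
      by (simp_all add: w)
    have "case_b_i br J X1 X2"
      unfolding case_b_i_def
      by (rule exI[of _ "wedge \<alpha>1 (\<alpha>1 \<circ> J) (J X1) X1"], rule exI[of _ "wedge \<alpha>2 (\<alpha>2 \<circ> J) (J X2) X2"],
          rule exI[of _ \<mu>1], rule exI[of _ \<mu>2]) (simp add: br zero m1 m2)
    with onb show ?thesis by blast
  next
    case ii
    then have "case_b_ii br J X1 X2" by (intro case_ii[OF onb split ind(2) cross])
    with onb show ?thesis by blast
  next
    case ii'
    then have "case_b_ii br J X2 X1" by (intro case_ii[OF onb' split' ind(1) cross(3,4,1,2)])
    with onb' show ?thesis by blast
  next
    case iii
    have "\<alpha>1 \<in> dual_space U" "\<alpha>2 \<in> dual_space U"
      by (rule dual_U_I[OF onb lin(1)] dual_U_I[OF onb lin(2)]; fact cross iii)+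
    then have "case_b_iii br J X1 X2"
      unfolding case_b_iii_def using ind(1)
      by (intro exI[of _ \<alpha>1] exI[of _ \<alpha>2]) (simp add: br w iii)
    with onb show ?thesis by blast
  qed
qed

end

subsection \<open>The isomorphisms\<close>

context almost_hermitian_lie_algebra
begin

text \<open>In all cases the isomorphism combines, for each direction \<open>X\<close> of \<open>\<gg>'\<close>, the coordinates
  \<open>(\<gamma>, (\<gamma> \<circ> J) / l)\<close> on \<open>aff\<^sub>\<real>\<close>, respectively \<open>(\<alpha>, \<alpha> \<circ> J, X)\<close> on \<open>h\<^sub>3\<close>, with a complement of
  coordinates vanishing on \<open>\<gg>'\<close>.\<close>

lemma one_form_J_independent:
  fixes \<alpha> :: "'a \<Rightarrow> real"
  assumes "linear \<alpha>" "\<alpha> \<noteq> (\<lambda>_. 0)" "\<And>x. p * \<alpha> x + q * \<alpha> (J x) = 0"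
  shows "p = 0 \<and> q = 0"
proof -
  obtain x where x: "\<alpha> x \<noteq> 0" using assms(2) by blast
  \<comment> \<open>Together with the relation at \<open>x\<close>, this multiplies p + iq by its
    conjugate.\<close>
  have "p * \<alpha> (J x) - q * \<alpha> x = 0" using assms(3)[of "J x"] by (simp add: one_form_J_J[OF assms(1)])
  then have "(p\<^sup>2 + q\<^sup>2) * \<alpha> x = 0" using assms(3)[of x] by algebra
  then show ?thesis using x by (simp add: sum_power2_eq_zero_iff)
qed

lemma iso_a_i:
  assumes split: "split_bracket (1 / l) \<gamma> X 0 (\<lambda>_. 0) 0" and l: "l \<noteq> 0" "\<gamma> X = 0" "\<gamma> (J X) = l"
    and X: "span {X} = \<gg>'" and k: "DIM('a) - 2 = k"
  shows "whole_alg br \<cong>\<^sub>L aff_alg \<oplus>\<^sub>L abelian_alg k"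
proof -
  have lin: "linear \<gamma>" and br: "\<And>x y. br x y = (1 / l * wedge \<gamma> (\<gamma> \<circ> J) x y) *\<^sub>R X"
    using split by (auto simp: split_bracket_def)
  note ln = linear_add[OF lin] linear_scale[OF lin] J_lin one_form_J_J[OF lin]
  \<comment> \<open>Dividing by \<open>l\<close> normalises \<open>F X\<close> to (0, 1), and the
    coefficient \<open>1 / l\<close> of the bracket becomes the one in the second
    coordinate.\<close>
  define F where "F x = (\<gamma> x, \<gamma> (J x) / l)" for x
  show ?thesis
    unfolding aff_alg_def
  proof (rule lie_isomorphic_sum_abelian[of F])
    show "linear F"
      unfolding F_def by (rule linearI) (simp_all add: ln add_divide_distrib)
    then show "range F = UNIV"
    proof (rule surj_if_no_annihilator)
      fix w :: "real \<times> real" assume w: "\<And>x. w \<bullet> F x = 0"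
      show "w = 0" using w[of X] w[of "J X"] l by (cases w) (simp add: F_def ln zero_prod_def)
    qed
    show "x = 0" if "x \<in> \<gg>'" "F x = 0" for x
      using that l by (auto simp: X[symmetric] span_singleton F_def ln zero_prod_def)
    show "F (br x y) = (\<lambda>(a, b) (c, d). (0, a * d - b * c)) (F x) (F y)" for x y
      using l by (simp add: F_def br ln wedge_def diff_divide_distrib)
    show "DIM('a) - DIM(real \<times> real) = k" using k by simp
  qed
qed

lemma iso_a_ii:
  assumes split: "split_bracket 1 \<alpha> X 0 (\<lambda>_. 0) 0" and \<alpha>: "\<alpha> \<noteq> (\<lambda>_. 0)" "\<alpha> \<in> dual_space U"
    and X: "span {X} = \<gg>'" "norm X = 1" and k: "DIM('a) - 3 = k"
  shows "whole_alg br \<cong>\<^sub>L h3_alg \<oplus>\<^sub>L abelian_alg k"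
proof -
  have lin: "linear \<alpha>" and br: "\<And>x y. br x y = wedge \<alpha> (\<alpha> \<circ> J) x y *\<^sub>R X"
    using split by (auto simp: split_bracket_def)
  have "X \<in> \<gg>'" using X(1) by (metis singletonI span_base)
  then have \<alpha>X: "\<alpha> X = 0" "\<alpha> (J X) = 0" using \<alpha>(2) by (auto simp: dual_U_iff)
  have XX: "X \<bullet> X = 1" using X(2) by (simp add: norm_eq_1)
  note ln = linear_add[OF lin] linear_scale[OF lin] J_lin one_form_J_J[OF lin]
  define F where "F x = (\<alpha> x, \<alpha> (J x), X \<bullet> x)" for x
  show ?thesis
    unfolding h3_alg_def
  proof (rule lie_isomorphic_sum_abelian[of F])
    show "linear F"
      unfolding F_def by (rule linearI) (simp_all add: ln inner_add_right)
    then show "range F = UNIV"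
    proof (rule surj_if_no_annihilator)
      fix w :: "real \<times> real \<times> real" assume w: "\<And>x. w \<bullet> F x = 0"
      obtain p q r where wd: "w = (p, q, r)" by (metis prod.exhaust)
      have "r = 0" using w[of X] by (simp add: wd F_def \<alpha>X XX)
      then have "p = 0 \<and> q = 0"
        using w by (intro one_form_J_independent[OF lin \<alpha>(1)]) (simp add: wd F_def)
      with \<open>r = 0\<close> show "w = 0" by (simp add: wd zero_prod_def)
    qed
    show "x = 0" if "x \<in> \<gg>'" "F x = 0" for x
      using that by (auto simp: X(1)[symmetric] span_singleton F_def XX zero_prod_def)
    show "F (br x y) = (\<lambda>(a, b, c) (a', b', c'). (0, 0, a * b' - b * a')) (F x) (F y)" for x y
      by (simp add: F_def br ln wedge_def \<alpha>X XX)
    show "DIM('a) - DIM(real \<times> real \<times> real) = k" using k by simp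
  qed
qed

context
  fixes X1 X2 :: 'a
  assumes onb: "orthonormal_basis2 \<gg>' X1 X2"
begin

text \<open>On the derived algebra \<open>p\<close> and \<open>q\<close> are the coordinates with
  respect to \<open>X1\<close>, \<open>X2\<close>; this gives injectivity there.\<close>

lemma zero_if_coordinates_zero:
  assumes "x \<in> \<gg>'" "linear p" "linear q" "p x = (0::real)" "q x = (0::real)"
    "p X1 = 1" "p X2 = 0" "q X1 = 0" "q X2 = 1"
  shows "x = 0"
proof -
  note x = onb_expand[OF onb assms(1)]
  have "p x = X1 \<bullet> x" by (subst x) (simp add: linear_add linear_scale assms)
  moreover have "q x = X2 \<bullet> x" by (subst x) (simp add: linear_add linear_scale assms)
  ultimately show ?thesis using x assms(4,5) by simp
qed

lemma iso_b_i:
  assumes split: "split_bracket (1 / l1) \<gamma>1 X1 (1 / l2) \<gamma>2 X2" and l: "l1 \<noteq> 0" "l2 \<noteq> 0"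
    and \<gamma>: "\<gamma>1 X1 = 0" "\<gamma>1 (J X1) = l1" "\<gamma>1 X2 = 0" "\<gamma>1 (J X2) = 0"
      "\<gamma>2 X2 = 0" "\<gamma>2 (J X2) = l2" "\<gamma>2 X1 = 0" "\<gamma>2 (J X1) = 0"
    and k: "DIM('a) - 4 = k"
  shows "whole_alg br \<cong>\<^sub>L aff_alg \<oplus>\<^sub>L aff_alg \<oplus>\<^sub>L abelian_alg k"
proof -
  have lin: "linear \<gamma>1" "linear \<gamma>2"
    and br: "\<And>x y. br x y = (1 / l1 * wedge \<gamma>1 (\<gamma>1 \<circ> J) x y) *\<^sub>R X1 + (1 / l2 * wedge \<gamma>2 (\<gamma>2 \<circ> J) x y) *\<^sub>R X2"
    using split by (auto simp: split_bracket_def)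
  note ln = linear_add[OF lin(1)] linear_add[OF lin(2)] linear_scale[OF lin(1)] linear_scale[OF lin(2)]
    J_lin one_form_J_J[OF lin(1)] one_form_J_J[OF lin(2)]
  let ?aff = "\<lambda>(a, b) (c, d). (0, a * d - b * c) :: real \<times> real"
  define F where "F x = ((\<gamma>1 x, \<gamma>1 (J x) / l1), (\<gamma>2 x, \<gamma>2 (J x) / l2))" for x
  have "whole_alg br \<cong>\<^sub>L whole_alg (\<lambda>u v. (?aff (fst u) (fst v), ?aff (snd u) (snd v))) \<oplus>\<^sub>L abelian_alg k"
  proof (rule lie_isomorphic_sum_abelian[of F])
    show "linear F"
      unfolding F_def by (rule linearI) (simp_all add: ln add_divide_distrib)
    then show "range F = UNIV"
    proof (rule surj_if_no_annihilator)
      fix w :: "(real \<times> real) \<times> (real \<times> real)" assume w: "\<And>x. w \<bullet> F x = 0"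
      obtain p q r s where wd: "w = ((p, q), (r, s))" by (metis prod.exhaust)
      show "w = 0" using w[of X1] w[of "J X1"] w[of X2] w[of "J X2"] l
        by (simp add: wd F_def ln \<gamma> zero_prod_def)
    qed
    show "x = 0" if "x \<in> \<gg>'" "F x = 0" for x
    proof (rule zero_if_coordinates_zero[OF that(1)])
      show "linear (\<lambda>x. \<gamma>1 (J x) / l1)" "linear (\<lambda>x. \<gamma>2 (J x) / l2)"
        by (rule linearI; simp add: ln add_divide_distrib)+
    qed (use that(2) l \<gamma> in \<open>simp_all add: F_def zero_prod_def\<close>)
    show "F (br x y) = (?aff (fst (F x)) (fst (F y)), ?aff (snd (F x)) (snd (F y)))" for x y
      using l by (simp add: F_def br ln \<gamma> wedge_def diff_divide_distrib)
    show "DIM('a) - DIM((real \<times> real) \<times> (real \<times> real)) = k" using k by simp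
  qed
  then show ?thesis unfolding aff_alg_def by (rule lie_isomorphic_assoc) simp
qed

lemma iso_b_ii:
  assumes split: "split_bracket (1 / l) \<gamma> X1 1 \<alpha> X2" and l: "l \<noteq> 0"
    and \<gamma>: "\<gamma> X1 = 0" "\<gamma> (J X1) = l" "\<gamma> X2 = 0" "\<gamma> (J X2) = 0"
    and \<alpha>: "\<alpha> \<noteq> (\<lambda>_. 0)" "\<alpha> \<in> dual_space U"
    and k: "DIM('a) - 5 = k"
  shows "whole_alg br \<cong>\<^sub>L aff_alg \<oplus>\<^sub>L h3_alg \<oplus>\<^sub>L abelian_alg k"
proof -
  have lin: "linear \<gamma>" "linear \<alpha>"
    and br: "\<And>x y. br x y = (1 / l * wedge \<gamma> (\<gamma> \<circ> J) x y) *\<^sub>R X1 + wedge \<alpha> (\<alpha> \<circ> J) x y *\<^sub>R X2"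
    using split by (auto simp: split_bracket_def)
  note ln = linear_add[OF lin(1)] linear_add[OF lin(2)] linear_scale[OF lin(1)] linear_scale[OF lin(2)]
    J_lin one_form_J_J[OF lin(1)] one_form_J_J[OF lin(2)]
  have \<alpha>X: "\<alpha> X1 = 0" "\<alpha> (J X1) = 0" "\<alpha> X2 = 0" "\<alpha> (J X2) = 0"
    using \<alpha>(2) onb_mem[OF onb] by (auto simp: dual_U_iff)
  note vals = \<gamma> \<alpha>X onb_inner[OF onb]
  let ?aff = "\<lambda>(a, b) (c, d). (0, a * d - b * c) :: real \<times> real"
  let ?h3 = "\<lambda>(a, b, c) (a', b', c'). (0, 0, a * b' - b * a') :: real \<times> real \<times> real"
  define F where "F x = ((\<gamma> x, \<gamma> (J x) / l), (\<alpha> x, \<alpha> (J x), X2 \<bullet> x))" for x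
  have "whole_alg br \<cong>\<^sub>L whole_alg (\<lambda>u v. (?aff (fst u) (fst v), ?h3 (snd u) (snd v))) \<oplus>\<^sub>L abelian_alg k"
  proof (rule lie_isomorphic_sum_abelian[of F])
    show "linear F"
      unfolding F_def by (rule linearI) (simp_all add: ln add_divide_distrib inner_add_right)
    then show "range F = UNIV"
    proof (rule surj_if_no_annihilator)
      fix w :: "(real \<times> real) \<times> (real \<times> real \<times> real)" assume w: "\<And>x. w \<bullet> F x = 0"
      obtain a b p q r where wd: "w = ((a, b), (p, q, r))" by (metis prod.exhaust)
      have "b = 0" "r = 0" using w[of X1] w[of X2] l by (simp_all add: wd F_def vals)
      \<comment> \<open>The order matters: \<open>J X1\<close> may have a component along
        \<open>X2\<close>, so \<open>a\<close> is isolated only once \<open>r = 0\<close> is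
        known.\<close>
      moreover from this have "a = 0" using w[of "J X1"] l by (simp add: wd F_def vals ln)
      ultimately have "p = 0 \<and> q = 0"
        using w by (intro one_form_J_independent[OF lin(2) \<alpha>(1)]) (simp add: wd F_def)
      with \<open>a = 0\<close> \<open>b = 0\<close> \<open>r = 0\<close> show "w = 0" by (simp add: wd zero_prod_def)
    qed
    show "x = 0" if "x \<in> \<gg>'" "F x = 0" for x
    proof (rule zero_if_coordinates_zero[OF that(1)])
      show "linear (\<lambda>x. \<gamma> (J x) / l)" "linear (\<lambda>x. X2 \<bullet> x)"
        by (rule linearI; simp add: ln add_divide_distrib inner_add_right)+
    qed (use that(2) l vals in \<open>simp_all add: F_def zero_prod_def\<close>)
    show "F (br x y) = (?aff (fst (F x)) (fst (F y)), ?h3 (snd (F x)) (snd (F y)))" for x y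
      using l by (simp add: F_def br ln vals wedge_def diff_divide_distrib inner_add_right)
    show "DIM('a) - DIM((real \<times> real) \<times> (real \<times> real \<times> real)) = k" using k by simp
  qed
  then show ?thesis unfolding aff_alg_def h3_alg_def by (rule lie_isomorphic_assoc) simp
qed

lemma iso_b_iii:
  assumes split: "split_bracket 1 \<alpha> X1 1 \<beta> X2" and ind: "complex_independent J \<alpha> \<beta>"
    and dual: "\<alpha> \<in> dual_space U" "\<beta> \<in> dual_space U" and k: "DIM('a) - 6 = k"
  shows "whole_alg br \<cong>\<^sub>L h3_alg \<oplus>\<^sub>L h3_alg \<oplus>\<^sub>L abelian_alg k"
proof -
  have lin: "linear \<alpha>" "linear \<beta>"
    and br: "\<And>x y. br x y = wedge \<alpha> (\<alpha> \<circ> J) x y *\<^sub>R X1 + wedge \<beta> (\<beta> \<circ> J) x y *\<^sub>R X2"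
    using split by (auto simp: split_bracket_def)
  note ln = linear_add[OF lin(1)] linear_add[OF lin(2)] linear_scale[OF lin(1)] linear_scale[OF lin(2)]
    J_lin one_form_J_J[OF lin(1)] one_form_J_J[OF lin(2)]
  have "\<alpha> X1 = 0" "\<alpha> (J X1) = 0" "\<alpha> X2 = 0" "\<alpha> (J X2) = 0"
    "\<beta> X1 = 0" "\<beta> (J X1) = 0" "\<beta> X2 = 0" "\<beta> (J X2) = 0"
    using dual onb_mem[OF onb] by (auto simp: dual_U_iff)
  note vals = this onb_inner[OF onb]
  let ?h3 = "\<lambda>(a, b, c) (a', b', c'). (0, 0, a * b' - b * a') :: real \<times> real \<times> real"
  define F where "F x = ((\<alpha> x, \<alpha> (J x), X1 \<bullet> x), (\<beta> x, \<beta> (J x), X2 \<bullet> x))" for x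
  have "whole_alg br \<cong>\<^sub>L whole_alg (\<lambda>u v. (?h3 (fst u) (fst v), ?h3 (snd u) (snd v))) \<oplus>\<^sub>L abelian_alg k"
  proof (rule lie_isomorphic_sum_abelian[of F])
    show "linear F"
      unfolding F_def by (rule linearI) (simp_all add: ln inner_add_right)
    then show "range F = UNIV"
    proof (rule surj_if_no_annihilator)
      fix w :: "(real \<times> real \<times> real) \<times> (real \<times> real \<times> real)" assume w: "\<And>x. w \<bullet> F x = 0"
      obtain a b c p q r where wd: "w = ((a, b, c), (p, q, r))" by (metis prod.exhaust)
      \<comment> \<open>\<open>X1\<close> and \<open>X2\<close> are killed by all four one-forms and
        isolate \<open>c\<close> and \<open>r\<close>; what remains is a complex linear relation
        between \<open>\<alpha>\<close> and \<open>\<beta>\<close>.\<close>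
      have cr: "c = 0" "r = 0" using w[of X1] w[of X2] by (simp_all add: wd F_def vals)
      have "cscale J (Complex a b) \<alpha> x + cscale J (Complex p q) \<beta> x = 0" for x
        using w[of x] by (simp add: wd F_def cscale_def cr)
      then have "Complex a b = 0 \<and> Complex p q = 0"
        using ind unfolding complex_independent_def by blast
      then show "w = 0" by (simp add: wd cr complex_eq_iff zero_prod_def)
    qed
    show "x = 0" if "x \<in> \<gg>'" "F x = 0" for x
    proof (rule zero_if_coordinates_zero[OF that(1)])
      show "linear (\<lambda>x. X1 \<bullet> x)" "linear (\<lambda>x. X2 \<bullet> x)"
        by (rule linearI; simp add: inner_add_right)+
    qed (use that(2) vals in \<open>simp_all add: F_def zero_prod_def\<close>)
    show "F (br x y) = (?h3 (fst (F x)) (fst (F y)), ?h3 (snd (F x)) (snd (F y)))" for x y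
      by (simp add: F_def br ln vals wedge_def inner_add_right)
    show "DIM('a) - DIM((real \<times> real \<times> real) \<times> (real \<times> real \<times> real)) = k" using k by simp
  qed
  then show ?thesis unfolding h3_alg_def by (rule lie_isomorphic_assoc) simp
qed

end

section \<open>Assembling the equivalences and the isomorphisms\<close>

lemma derived_dim1:
  assumes "dim \<gg>' = 1"
  shows "SKT br J \<longleftrightarrow> (\<exists>X\<in>\<gg>'. norm X = 1 \<and> (case_a_i br J X \<or> case_a_ii br J X))"
    and "X \<in> \<gg>' \<Longrightarrow> norm X = 1 \<Longrightarrow> case_a_i br J X \<Longrightarrow>
      whole_alg br \<cong>\<^sub>L aff_alg \<oplus>\<^sub>L abelian_alg (DIM('a) - 2)"
    and "X \<in> \<gg>' \<Longrightarrow> norm X = 1 \<Longrightarrow> case_a_ii br J X \<Longrightarrow>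
      whole_alg br \<cong>\<^sub>L h3_alg \<oplus>\<^sub>L abelian_alg (DIM('a) - 3)"
proof -
  have span: "span {X} = \<gg>'" if "X \<in> \<gg>'" "norm X = 1" for X
  proof -
    have "independent {X}" using that(2) by (auto simp: independent_insert)
    then have "dim (span {X}) = dim \<gg>'" using assms dim_eq_card_independent[of "{X}"] by simp
    moreover have "span {X} \<subseteq> \<gg>'" using that(1) subspace_derived by (simp add: span_minimal)
    ultimately show ?thesis using subspace_derived by (intro subspace_dim_equal) simp_all
  qed
  show "SKT br J \<longleftrightarrow> (\<exists>X\<in>\<gg>'. norm X = 1 \<and> (case_a_i br J X \<or> case_a_ii br J X))"
  proof
    assume "\<exists>X\<in>\<gg>'. norm X = 1 \<and> (case_a_i br J X \<or> case_a_ii br J X)"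
    then obtain X c \<gamma> where "split_bracket c \<gamma> X 0 (\<lambda>_. 0) 0"
      using span split_if_case_a_i split_if_case_a_ii by metis
    from SKT_if_split[OF this _ totally_real_dim1[OF assms]] show "SKT br J" by simp
  qed (rule case_a_if_SKT[OF _ assms])
  show "whole_alg br \<cong>\<^sub>L aff_alg \<oplus>\<^sub>L abelian_alg (DIM('a) - 2)"
    if "X \<in> \<gg>'" "norm X = 1" "case_a_i br J X"
    using split_if_case_a_i[OF that(3) span[OF that(1,2)] that(2)] iso_a_i span[OF that(1,2)] by metis
  show "whole_alg br \<cong>\<^sub>L h3_alg \<oplus>\<^sub>L abelian_alg (DIM('a) - 3)"
    if "X \<in> \<gg>'" "norm X = 1" "case_a_ii br J X"
    using split_if_case_a_ii[OF that(3) span[OF that(1,2)] that(2)] iso_a_ii span[OF that(1,2)] that(2) by metis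
qed

lemma derived_dim2_SKT_iff:
  assumes "dim \<gg>' = 2" "totally_real J \<gg>'"
  shows "SKT br J \<longleftrightarrow> (\<exists>X1 X2. orthonormal_basis2 \<gg>' X1 X2 \<and>
    (case_b_i br J X1 X2 \<or> case_b_ii br J X1 X2 \<or> case_b_iii br J X1 X2))"
proof
  assume "\<exists>X1 X2. orthonormal_basis2 \<gg>' X1 X2 \<and>
    (case_b_i br J X1 X2 \<or> case_b_ii br J X1 X2 \<or> case_b_iii br J X1 X2)"
  then obtain X1 X2 where onb: "orthonormal_basis2 \<gg>' X1 X2"
    and "case_b_i br J X1 X2 \<or> case_b_ii br J X1 X2 \<or> case_b_iii br J X1 X2" by blast
  then obtain c1 \<gamma>1 c2 \<gamma>2 where "split_bracket c1 \<gamma>1 X1 c2 \<gamma>2 X2"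
    using split_if_case_b_i[OF onb] split_if_case_b_ii[OF onb] split_if_case_b_iii[OF onb] by metis
  then show "SKT br J" using onb_inner(3)[OF onb] assms(2) by (rule SKT_if_split)
qed (rule case_b_if_SKT[OF _ assms(2,1)])

lemma derived_dim2_isomorphic:
  assumes "orthonormal_basis2 \<gg>' X1 X2"
  shows "case_b_i br J X1 X2 \<Longrightarrow>
      whole_alg br \<cong>\<^sub>L aff_alg \<oplus>\<^sub>L aff_alg \<oplus>\<^sub>L abelian_alg (DIM('a) - 4)"
    and "case_b_ii br J X1 X2 \<Longrightarrow>
      whole_alg br \<cong>\<^sub>L aff_alg \<oplus>\<^sub>L h3_alg \<oplus>\<^sub>L abelian_alg (DIM('a) - 5)"
    and "case_b_iii br J X1 X2 \<Longrightarrow>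
      whole_alg br \<cong>\<^sub>L h3_alg \<oplus>\<^sub>L h3_alg \<oplus>\<^sub>L abelian_alg (DIM('a) - 6)"
  subgoal by (erule split_if_case_b_i[OF assms]) (rule iso_b_i[OF assms]; assumption?; rule refl)
  subgoal by (erule split_if_case_b_ii[OF assms]) (rule iso_b_ii[OF assms]; assumption?; rule refl)
  subgoal by (erule split_if_case_b_iii[OF assms]) (rule iso_b_iii[OF assms]; assumption?; rule refl)
  done

end

theorem corollary5p11:
  fixes br :: "'a::euclidean_space \<Rightarrow> 'a \<Rightarrow> 'a" and J :: "'a \<Rightarrow> 'a" and n :: nat
  assumes "almost_hermitian_lie_algebra br J" and "DIM('a) = 2 * n"
  shows
    "(dim (derived_algebra br) = 1 \<longrightarrow>
        (SKT br J \<longleftrightarrow>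
          (\<exists>X \<in> derived_algebra br. norm X = 1 \<and> (case_a_i br J X \<or> case_a_ii br J X))) \<and>
        (\<forall>X \<in> derived_algebra br. norm X = 1 \<longrightarrow>
          (case_a_i br J X \<longrightarrow> whole_alg br \<cong>\<^sub>L aff_alg \<oplus>\<^sub>L abelian_alg (2 * n - 2)) \<and>
          (case_a_ii br J X \<longrightarrow> whole_alg br \<cong>\<^sub>L h3_alg \<oplus>\<^sub>L abelian_alg (2 * n - 3))))
     \<and>
     (dim (derived_algebra br) = 2 \<and> totally_real J (derived_algebra br) \<longrightarrow>
        (SKT br J \<longleftrightarrow>
          (\<exists>X1 X2. orthonormal_basis2 (derived_algebra br) X1 X2 \<and>
             (case_b_i br J X1 X2 \<or> case_b_ii br J X1 X2 \<or> case_b_iii br J X1 X2))) \<and>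
        (\<forall>X1 X2. orthonormal_basis2 (derived_algebra br) X1 X2 \<longrightarrow>
          (case_b_i br J X1 X2 \<longrightarrow>
             whole_alg br \<cong>\<^sub>L aff_alg \<oplus>\<^sub>L aff_alg \<oplus>\<^sub>L abelian_alg (2 * n - 4)) \<and>
          (case_b_ii br J X1 X2 \<longrightarrow>
             whole_alg br \<cong>\<^sub>L aff_alg \<oplus>\<^sub>L h3_alg \<oplus>\<^sub>L abelian_alg (2 * n - 5)) \<and>
          (case_b_iii br J X1 X2 \<longrightarrow>
             whole_alg br \<cong>\<^sub>L h3_alg \<oplus>\<^sub>L h3_alg \<oplus>\<^sub>L abelian_alg (2 * n - 6))))"
proof -
  interpret almost_hermitian_lie_algebra br J by (rule assms(1))
  show ?thesis
    using derived_dim1 derived_dim2_SKT_iff derived_dim2_isomorphic unfolding assms(2) by blast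
qed

end
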